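(* Let $\mathbb{F}$ be a finite field and let $S, X, \ell, K_c, p, m, n, \lambda, \kappa, \mu$ be positive integers with $m\mid\lambda$, $p\mid\kappa$, $n\mid\mu$, $L=\ell K_c$ and $L\le|\mathbb{F}|-S$. Set $R=pmn(\ell+1)K_c+2X-1$ and assume $S\ge R$. Then the GCSA-NA scheme (described in the context) is an SMBMM code with $X$-security. Specifically: (i) (Correctness) For every $\mathcal{R}\subset[S]$ with $|\mathcal{R}|=R$ and every realization of $\mathbf{A},\mathbf{B}$ and of all noise, the products $\mathbf{A}^{(1)}\mathbf{B}^{(1)},\dots,\mathbf{A}^{(L)}\mathbf{B}^{(L)}$ are a deterministic function of $(Y_s)_{s\in\mathcal{R}}$; that is, the scheme is $R$-recoverable. (ii) (Security) For every $\mathcal{X}\subset[S]$ with $|\mathcal{X}|\le X$, $I(\mathbf{A},\mathbf{B};\widetilde{A}^{\mathcal{X}},\widetilde{B}^{\mathcal{X}},\mathcal{M}_{\mathcal{X}})=0$. (iii) (Strong security) $I(\mathbf{A},\mathbf{B},\widetilde{A}^{[S]},\widetilde{B}^{[S]};\mathcal{M})=0$. (iv) (Privacy) $I(\mathbf{A},\mathbf{B};Y_1,\dots,Y_S\mid \mathbf{A}\mathbf{B})=0$. (v) (Costs) The normalized upload costs are $U_A=\frac{S}{K_cpm}$, $U_B=\frac{S}{K_cpn}$, the normalized server communication cost is $CC=\frac{S-1}{\ell K_cmn}$, and the normalized master download cost is $D=\frac{R}{\ell K_c mn}$.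
   Context: Setting (SMBMM). Two sources generate $\mathbf{A}=(\mathbf{A}^{(1)},\dots,\mathbf{A}^{(L)})$ with $\mathbf{A}^{(l)}\in\mathbb{F}^{\lambda\times\kappa}$ and $\mathbf{B}=(\mathbf{B}^{(1)},\dots,\mathbf{B}^{(L)})$ with $\mathbf{B}^{(l)}\in\mathbb{F}^{\kappa\times\mu}$; $\mathbf{A}$ and $\mathbf{B}$ are independent random variables (arbitrary distributions). The master wants $\mathbf{AB}=(\mathbf{A}^{(1)}\mathbf{B}^{(1)},\dots,\mathbf{A}^{(L)}\mathbf{B}^{(L)})$. Source A sends a share $\widetilde{A}^s$ and source B a share $\widetilde{B}^s$ to server $s\in[S]$. $M_{s\to s'}$ is the message from server $s$ to server $s'$; $\mathcal{M}_s=\{M_{s'\to s}: s'\ne s\}$, $\mathcal{M}=\{\mathcal{M}_s: s\in[S]\}$, and for $\mathcal{X}\subset[S]$, $\mathcal{M}_{\mathcal{X}}=\{\mathcal{M}_s:s\in\mathcal{X}\}$. Server $s$ sends answer $Y_s$ (a function of $\widetilde{A}^s,\widetilde{B}^s,\mathcal{M}_s$) to the master. For a matrix $M$, $|M|$ is its number of entries. Costs: $U_A=\sum_s|\widetilde{A}^s|/(L\lambda\kappa)$, $U_B=\sum_s|\widetilde{B}^s|/(L\kappa\mu)$, $CC=|\mathcal{M}|/(L\lambda\mu)$ (total number of entries of all inter-server messages), $D=\max_{|\mathcal{R}|=R}\sum_{s\in\mathcal{R}}|Y_s|/(L\lambda\mu)$. GCSA-NA construction. Write $\mathbf{A}^{l,k}=\mathbf{A}^{(K_c(l-1)+k)}$,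 $\mathbf{B}^{l,k}=\mathbf{B}^{(K_c(l-1)+k)}$ for $l\in[\ell],k\in[K_c]$. Partition $\mathbf{A}^{l,k}$ into an $m\times p$ grid of blocks $\mathbf{A}^{l,k}_{i,j}\in\mathbb{F}^{\frac{\lambda}{m}\times\frac{\kappa}{p}}$ and $\mathbf{B}^{l,k}$ into a $p\times n$ grid of blocks $\mathbf{B}^{l,k}_{i,j}\in\mathbb{F}^{\frac{\kappa}{p}\times\frac{\mu}{n}}$. Fix $S+L$ distinct publicly known elements $f_{1,1},\dots,f_{\ell,K_c},\alpha_1,\dots,\alpha_S\in\mathbb{F}$. Let $R'=pmn$, $D_E=\max(pm,\,pmn-pm+p)-1$, $\mathcal{E}=\{p+p(m'-1)+pm(n''-1): m'\in[m],n''\in[n]\}\subseteq[R']$, and $\Delta_s^{l}=\prod_{k\in[K_c]}(f_{l,k}-\alpha_s)^{R'}$. Let $c_{l,k,i}$ be the coefficients of $\Psi_{l,k}(\alpha)=\prod_{k'\in[K_c]\setminus\{k\}}(\alpha+f_{l,k'}-f_{l,k})^{R'}=\sum_{i=0}^{R'(K_c-1)}c_{l,k,i}\alpha^i$, with $c_{l,k,i}=0$ for $i>R'(K_c-1)$. Define $P_s^{l,k}=\sum_{m'\in[m]}\sum_{p'\in[p]}\mathbf{A}^{l,k}_{m',p'}(f_{l,k}-\alpha_s)^{p'-1+p(m'-1)}$ and $Q_s^{l,k}=\sum_{p''\in[p]}\sum_{n''\in[n]}\mathbf{B}^{l,k}_{p'',n''}(f_{l,k}-\alpha_s)^{p-p''+pm(n''-1)}$.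 Source noise: $\mathbf{Z}^A_{l,x}\in\mathbb{F}^{\frac{\lambda}{m}\times\frac{\kappa}{p}}$, $\mathbf{Z}^B_{l,x}\in\mathbb{F}^{\frac{\kappa}{p}\times\frac{\mu}{n}}$, $l\in[\ell],x\in[X]$. Shares: $\widetilde{A}^s=(\widetilde{A}^s_1,\dots,\widetilde{A}^s_\ell)$, $\widetilde{B}^s=(\widetilde{B}^s_1,\dots,\widetilde{B}^s_\ell)$ with $\widetilde{A}^s_l=\Delta_s^{l}\big(\sum_{k\in[K_c]}\frac{P_s^{l,k}}{(f_{l,k}-\alpha_s)^{R'}}+\sum_{x\in[X]}\alpha_s^{x-1}\mathbf{Z}^A_{l,x}\big)$, $\widetilde{B}^s_l=\sum_{k\in[K_c]}\frac{Q_s^{l,k}}{(f_{l,k}-\alpha_s)^{R'}}+\sum_{x\in[X]}\alpha_s^{x-1}\mathbf{Z}^B_{l,x}$. Server noise, generated by server 1, all in $\mathbb{F}^{\frac{\lambda}{m}\times\frac{\mu}{n}}$: $\mathbf{Z}'_i$ for $i\in[R'(K_c-1)+X+D_E]$, and $\mathbf{Z}''_{l,k,i}$ for $l\in[\ell],k\in[K_c],i\in[R']$, where $\mathbf{Z}''_{l,k,i}=\mathbf{0}$ if $i\in\mathcal{E}$ and $\mathbf{Z}''_{l,k,i}=\mathbf{Z}'''_{l,k,i}$ otherwise. All of $\mathbf{Z}^A_{l,x},\mathbf{Z}^B_{l,x},\mathbf{Z}'_i,\mathbf{Z}'''_{l,k,i}$ are uniformly distributed on their matrix spaces, mutually independent,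 and independent of $(\mathbf{A},\mathbf{B})$. Server 1 computes, for every $s\in[S]$, $\widetilde{M}_s=\sum_{x\in[R'(K_c-1)+X+D_E]}\alpha_s^{x-1}\mathbf{Z}'_x+\sum_{l\in[\ell]}\sum_{k\in[K_c]}\sum_{i=0}^{R'-1}\frac{\sum_{i'=0}^{i}c_{l,k,i-i'}\mathbf{Z}''_{l,k,i'+1}}{(f_{l,k}-\alpha_s)^{R'-i}}$, and sends $M_{1\to s}=\widetilde{M}_s$ to each server $s\ne1$; there are no other inter-server messages. Each server $s$ returns $Y_s=\sum_{l\in[\ell]}\widetilde{A}^s_l\widetilde{B}^s_l+\widetilde{M}_s$. *)

theory Defs
  imports "Jordan_Normal_Form.Matrix" "HOL-Probability.Probability"
    "HOL-Computational_Algebra.Polynomial"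
begin

text \<open>Mutual information of two discrete random variables on a pmf space:
  exactly the library abbreviation \<open>\<I>(X ; Y)\<close> of the information_space locale
  (base-2 logarithm), written with the global constant.\<close>
definition MI :: "'w pmf \<Rightarrow> ('w \<Rightarrow> 'x) \<Rightarrow> ('w \<Rightarrow> 'y) \<Rightarrow> real" where
  "MI P Xv Yv = prob_space.mutual_information (measure_pmf P) 2
     (count_space (Xv ` space (measure_pmf P))) (count_space (Yv ` space (measure_pmf P))) Xv Yv"

definition CMI :: "'w pmf \<Rightarrow> ('w \<Rightarrow> 'x) \<Rightarrow> ('w \<Rightarrow> 'y) \<Rightarrow> ('w \<Rightarrow> 'z) \<Rightarrow> real" where
  "CMI P Xv Yv Zv = prob_space.conditional_mutual_information (measure_pmf P) 2
     (count_space (Xv ` space (measure_pmf P))) (count_space (Yv ` space (measure_pmf P)))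
     (count_space (Zv ` space (measure_pmf P))) Xv Yv Zv"

record 'a gparams =
  gS :: nat  gX :: nat  gell :: nat  gKc :: nat  gp :: nat  gm :: nat  gn :: nat
  glam :: nat  gkap :: nat  gmu :: nat
  gf :: "nat \<Rightarrow> nat \<Rightarrow> 'a"
  galpha :: "nat \<Rightarrow> 'a"

definition gL :: "'a gparams \<Rightarrow> nat" where "gL G = gell G * gKc G"
definition gR' :: "'a gparams \<Rightarrow> nat" where "gR' G = gp G * gm G * gn G"
definition gR :: "'a gparams \<Rightarrow> nat" where
  "gR G = gp G * gm G * gn G * (gell G + 1) * gKc G + 2 * gX G - 1"
definition gDE :: "'a gparams \<Rightarrow> nat" where
  "gDE G = max (gp G * gm G) (gp G * gm G * gn G - gp G * gm G + gp G) - 1"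
definition gE :: "'a gparams \<Rightarrow> nat set" where
  "gE G = {gp G + gp G * (m' - 1) + gp G * gm G * (n'' - 1) | m' n''.
             m' \<in> {1..gm G} \<and> n'' \<in> {1..gn G}}"

definition rA :: "'a gparams \<Rightarrow> nat" where "rA G = glam G div gm G"
definition cA :: "'a gparams \<Rightarrow> nat" where "cA G = gkap G div gp G"
definition cB :: "'a gparams \<Rightarrow> nat" where "cB G = gmu G div gn G"

definition msum :: "nat \<Rightarrow> nat \<Rightarrow> 'i set \<Rightarrow> ('i \<Rightarrow> 'a::comm_monoid_add mat) \<Rightarrow> 'a mat" where
  "msum r c I F = Matrix.mat r c (\<lambda>(i, j). \<Sum>x\<in>I. F x $$ (i, j))"

definition msize :: "'a mat \<Rightarrow> nat" where "msize M = dim_row M * dim_col M"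

record 'a noise =
  nZA :: "nat \<times> nat \<Rightarrow> 'a mat"
  nZB :: "nat \<times> nat \<Rightarrow> 'a mat"
  nZ1 :: "nat \<Rightarrow> 'a mat"
  nZ3 :: "nat \<times> nat \<times> nat \<Rightarrow> 'a mat"

type_synonym 'a outcome = "(nat \<Rightarrow> 'a mat) \<times> (nat \<Rightarrow> 'a mat) \<times> 'a noise"

definition oA :: "'a outcome \<Rightarrow> nat \<Rightarrow> 'a mat" where "oA w = fst w"
definition oB :: "'a outcome \<Rightarrow> nat \<Rightarrow> 'a mat" where "oB w = fst (snd w)"
definition oN :: "'a outcome \<Rightarrow> 'a noise" where "oN w = snd (snd w)"

definition NZ1 :: "'a gparams \<Rightarrow> nat" where
  "NZ1 G = gR' G * (gKc G - 1) + gX G + gDE G"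

definition Aspace :: "'a gparams \<Rightarrow> (nat \<Rightarrow> 'a mat) set" where
  "Aspace G = PiE {1..gL G} (\<lambda>_. carrier_mat (glam G) (gkap G))"
definition Bspace :: "'a gparams \<Rightarrow> (nat \<Rightarrow> 'a mat) set" where
  "Bspace G = PiE {1..gL G} (\<lambda>_. carrier_mat (gkap G) (gmu G))"

definition NoiseSpace :: "'a gparams \<Rightarrow> 'a noise set" where
  "NoiseSpace G = {z.
     nZA z \<in> PiE ({1..gell G} \<times> {1..gX G}) (\<lambda>_. carrier_mat (rA G) (cA G)) \<and>
     nZB z \<in> PiE ({1..gell G} \<times> {1..gX G}) (\<lambda>_. carrier_mat (cA G) (cB G)) \<and>
     nZ1 z \<in> PiE {1..NZ1 G} (\<lambda>_. carrier_mat (rA G) (cB G)) \<and>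
     nZ3 z \<in> PiE {(l, k, i). l \<in> {1..gell G} \<and> k \<in> {1..gKc G} \<and> i \<in> {1..gR' G} - gE G}
                (\<lambda>_. carrier_mat (rA G) (cB G))}"

definition Omega :: "'a gparams \<Rightarrow> 'a outcome set" where
  "Omega G = Aspace G \<times> Bspace G \<times> NoiseSpace G"

definition joint :: "'a gparams \<Rightarrow> (nat \<Rightarrow> 'a mat) pmf \<Rightarrow> (nat \<Rightarrow> 'a mat) pmf \<Rightarrow> 'a outcome pmf" where
  "joint G pA pB = bind_pmf pA (\<lambda>A. bind_pmf pB (\<lambda>B.
      bind_pmf (pmf_of_set (NoiseSpace G)) (\<lambda>Z. return_pmf (A, B, Z))))"

definition Delta :: "'a::field gparams \<Rightarrow> nat \<Rightarrow> nat \<Rightarrow> 'a" where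
  "Delta G s l = (\<Prod>k\<in>{1..gKc G}. (gf G l k - galpha G s) ^ gR' G)"

definition cc :: "'a::field gparams \<Rightarrow> nat \<Rightarrow> nat \<Rightarrow> nat \<Rightarrow> 'a" where
  "cc G l k i = coeff (\<Prod>k'\<in>{1..gKc G} - {k}. [:gf G l k' - gf G l k, 1:] ^ gR' G) i"

definition blkA :: "'a gparams \<Rightarrow> 'a mat \<Rightarrow> nat \<Rightarrow> nat \<Rightarrow> 'a mat" where
  "blkA G M i j = Matrix.mat (rA G) (cA G) (\<lambda>(r, c). M $$ ((i - 1) * rA G + r, (j - 1) * cA G + c))"
definition blkB :: "'a gparams \<Rightarrow> 'a mat \<Rightarrow> nat \<Rightarrow> nat \<Rightarrow> 'a mat" where
  "blkB G M i j = Matrix.mat (cA G) (cB G) (\<lambda>(r, c). M $$ ((i - 1) * cA G + r, (j - 1) * cB G + c))"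

definition PP :: "'a::field gparams \<Rightarrow> 'a outcome \<Rightarrow> nat \<Rightarrow> nat \<Rightarrow> nat \<Rightarrow> 'a mat" where
  "PP G w s l k = msum (rA G) (cA G) ({1..gm G} \<times> {1..gp G})
     (\<lambda>(m', p'). (gf G l k - galpha G s) ^ (p' - 1 + gp G * (m' - 1))
                  \<cdot>\<^sub>m blkA G (oA w (gKc G * (l - 1) + k)) m' p')"

definition QQ :: "'a::field gparams \<Rightarrow> 'a outcome \<Rightarrow> nat \<Rightarrow> nat \<Rightarrow> nat \<Rightarrow> 'a mat" where
  "QQ G w s l k = msum (cA G) (cB G) ({1..gp G} \<times> {1..gn G})
     (\<lambda>(p'', n''). (gf G l k - galpha G s) ^ (gp G - p'' + gp G * gm G * (n'' - 1))
                  \<cdot>\<^sub>m blkB G (oB w (gKc G * (l - 1) + k)) p'' n'')"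

definition At :: "'a::field gparams \<Rightarrow> 'a outcome \<Rightarrow> nat \<Rightarrow> nat \<Rightarrow> 'a mat" where
  "At G w s l = Delta G s l \<cdot>\<^sub>m
     (msum (rA G) (cA G) {1..gKc G}
        (\<lambda>k. (1 / (gf G l k - galpha G s) ^ gR' G) \<cdot>\<^sub>m PP G w s l k)
    + msum (rA G) (cA G) {1..gX G} (\<lambda>x. galpha G s ^ (x - 1) \<cdot>\<^sub>m nZA (oN w) (l, x)))"

definition Bt :: "'a::field gparams \<Rightarrow> 'a outcome \<Rightarrow> nat \<Rightarrow> nat \<Rightarrow> 'a mat" where
  "Bt G w s l =
     msum (cA G) (cB G) {1..gKc G}
        (\<lambda>k. (1 / (gf G l k - galpha G s) ^ gR' G) \<cdot>\<^sub>m QQ G w s l k)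
    + msum (cA G) (cB G) {1..gX G} (\<lambda>x. galpha G s ^ (x - 1) \<cdot>\<^sub>m nZB (oN w) (l, x))"

definition shareA :: "'a::field gparams \<Rightarrow> 'a outcome \<Rightarrow> nat \<Rightarrow> nat \<Rightarrow> 'a mat" where
  "shareA G w s = (\<lambda>l\<in>{1..gell G}. At G w s l)"
definition shareB :: "'a::field gparams \<Rightarrow> 'a outcome \<Rightarrow> nat \<Rightarrow> nat \<Rightarrow> 'a mat" where
  "shareB G w s = (\<lambda>l\<in>{1..gell G}. Bt G w s l)"

definition Z2 :: "'a::field gparams \<Rightarrow> 'a outcome \<Rightarrow> nat \<Rightarrow> nat \<Rightarrow> nat \<Rightarrow> 'a mat" where
  "Z2 G w l k i = (if i \<in> gE G then 0\<^sub>m (rA G) (cB G) else nZ3 (oN w) (l, k, i))"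

definition Mt :: "'a::field gparams \<Rightarrow> 'a outcome \<Rightarrow> nat \<Rightarrow> 'a mat" where
  "Mt G w s =
     msum (rA G) (cB G) {1..NZ1 G} (\<lambda>x. galpha G s ^ (x - 1) \<cdot>\<^sub>m nZ1 (oN w) x)
   + msum (rA G) (cB G) ({1..gell G} \<times> {1..gKc G} \<times> {0..<gR' G})
       (\<lambda>(l, k, i). (1 / (gf G l k - galpha G s) ^ (gR' G - i)) \<cdot>\<^sub>m
           msum (rA G) (cB G) {0..i} (\<lambda>i'. cc G l k (i - i') \<cdot>\<^sub>m Z2 G w l k (i' + 1)))"

text \<open>inter-server messages: \<open>msg w (s', s)\<close> is \<open>M_{s'\<rightarrow>s}\<close> (None = no message)\<close>
definition msg :: "'a::field gparams \<Rightarrow> 'a outcome \<Rightarrow> nat \<times> nat \<Rightarrow> 'a mat option" where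
  "msg G w = (\<lambda>(s', s). if s' = 1 \<and> s \<in> {2..gS G} then Some (Mt G w s) else None)"

definition Mrecv :: "'a::field gparams \<Rightarrow> 'a outcome \<Rightarrow> nat \<Rightarrow> nat \<Rightarrow> 'a mat option" where
  "Mrecv G w s = (\<lambda>s'\<in>{1..gS G} - {s}. msg G w (s', s))"

definition Mset :: "'a::field gparams \<Rightarrow> 'a outcome \<Rightarrow> nat set \<Rightarrow> nat \<Rightarrow> nat \<Rightarrow> 'a mat option" where
  "Mset G w Xs = (\<lambda>s\<in>Xs. Mrecv G w s)"

definition Yans :: "'a::field gparams \<Rightarrow> 'a outcome \<Rightarrow> nat \<Rightarrow> 'a mat" where
  "Yans G w s = msum (rA G) (cB G) {1..gell G} (\<lambda>l. At G w s l * Bt G w s l) + Mt G w s"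

definition UA :: "'a::field gparams \<Rightarrow> 'a outcome \<Rightarrow> real" where
  "UA G w = real (\<Sum>s\<in>{1..gS G}. \<Sum>l\<in>{1..gell G}. msize (At G w s l))
            / real (gL G * glam G * gkap G)"
definition UB :: "'a::field gparams \<Rightarrow> 'a outcome \<Rightarrow> real" where
  "UB G w = real (\<Sum>s\<in>{1..gS G}. \<Sum>l\<in>{1..gell G}. msize (Bt G w s l))
            / real (gL G * gkap G * gmu G)"
definition CC :: "'a::field gparams \<Rightarrow> 'a outcome \<Rightarrow> real" where
  "CC G w = real (\<Sum>s\<in>{1..gS G}. \<Sum>s'\<in>{1..gS G} - {s}.
               (case msg G w (s', s) of None \<Rightarrow> 0 | Some M \<Rightarrow> msize M))
            / real (gL G * glam G * gmu G)"
definition DD :: "'a::field gparams \<Rightarrow> 'a outcome \<Rightarrow> real" where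
  "DD G w = real (Max {\<Sum>s\<in>Rs. msize (Yans G w s) | Rs. Rs \<subseteq> {1..gS G} \<and> card Rs = gR G})
            / real (gL G * glam G * gmu G)"

end

theory Submission
  imports Defs
begin

text \<open>
  Fix an entry of the answer matrix. As a function of the evaluation point, the answer of a server is
  a rational function whose polar part at \<open>f_{l,k}\<close> is, in the local variable
  \<open>t = f_{l,k} - \<alpha>\<close>, the truncation modulo \<open>t^R'\<close> of \<open>\<Psi>_{l,k}(t) (C(t) + Z''(t))\<close>, where
  \<open>C = P Q\<close> carries the blocks of the desired product at the exponents indexed by \<open>\<E>\<close>, and \<open>Z''\<close>
  vanishes there. The regular part has at most \<open>R' K_c + 2X - 1\<close> coefficients, so \<open>R\<close> answers determine
  the rational function, hence its polar parts, hence (as \<open>\<Psi>_{l,k}(0) \<noteq> 0\<close>) the coefficients of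
  \<open>C + Z''\<close>.

  Privacy and security are coupling arguments: changing the inputs can be compensated by a bijective
  translation of the uniform noise. For security the sources' noise is translated by an interpolating
  polynomial through at most \<open>X\<close> servers. For privacy \<open>Z'''\<close> is translated by the change of the
  coefficients of \<open>C\<close> outside \<open>\<E>\<close>, and \<open>Z'\<close> by the change of the regular part; the coefficients of
  the regular part beyond the reach of \<open>Z'\<close> come from the product of the sources' noises only and do
  not involve the inputs.
\<close>

section \<open>Mutual information of finitely supported distributions\<close>

text \<open>The target spaces of \<open>MI\<close> and \<open>CMI\<close> are counting measures on possibly uncountable ranges, hence not
  sigma-finite, so the density-based formulas of the library do not apply.\<close>

lemma mutual_information_finite_pmf:
  fixes P :: "'w pmf"
  assumes fin: "finite (set_pmf P)" and b: "1 < b"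
    and X: "X \<in> measurable (measure_pmf P) S" and Y: "Y \<in> measurable (measure_pmf P) T"
    and SX: "\<And>w. w \<in> set_pmf P \<Longrightarrow> {X w} \<in> sets S"
    and TY: "\<And>w. w \<in> set_pmf P \<Longrightarrow> {Y w} \<in> sets T"
  shows "prob_space.mutual_information (measure_pmf P) b S T X Y =
    (\<Sum>w\<in>set_pmf P. pmf P w * log b (pmf (map_pmf (\<lambda>w. (X w, Y w)) P) (X w, Y w)
        / (pmf (map_pmf X P) (X w) * pmf (map_pmf Y P) (Y w))))"
proof -
  note [measurable] = X Y
  have XY: "(\<lambda>w. (X w, Y w)) \<in> measurable (measure_pmf P) (S \<Otimes>\<^sub>M T)"
    by (rule measurable_Pair[OF X Y])
  define J where "J = map_pmf (\<lambda>w. (X w, Y w)) P"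
  define f where "f z = pmf J z / (pmf (map_pmf X P) (fst z) * pmf (map_pmf Y P) (snd z))" for z
  define F where "F = (X ` set_pmf P) \<times> (Y ` set_pmf P)"
  let ?DX = "distr (measure_pmf P) S X" and ?DY = "distr (measure_pmf P) T Y"
  let ?DJ = "distr (measure_pmf P) (S \<Otimes>\<^sub>M T) (\<lambda>w. (X w, Y w))"
  interpret DX: prob_space ?DX by (rule measure_pmf.prob_space_distr[OF X])
  interpret DY: prob_space ?DY by (rule measure_pmf.prob_space_distr[OF Y])
  interpret D: pair_prob_space ?DX ?DY ..
  have finF: "finite F" using fin by (simp add: F_def)
  have f0: "f z = 0" if "z \<notin> F" for z
  proof -
    have "z \<notin> set_pmf J" using that by (auto simp: J_def F_def)
    then show ?thesis by (simp add: f_def set_pmf_iff)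
  qed
  \<comment> \<open>Only points of attained values are assumed measurable, so measurability of
    \<open>f\<close> is obtained by writing it as a finite combination of indicators of points of
    \<open>F\<close>.\<close>
  have f_eq: "f = (\<lambda>z. \<Sum>z0\<in>F. f z0 * indicator {z0} z)"
  proof
    fix z show "f z = (\<Sum>z0\<in>F. f z0 * indicator {z0} z)"
      using finF f0[of z] by (cases "z \<in> F") (auto simp: indicator_def sum.delta if_distrib cong: if_cong)
  qed
  have meas_sing: "{z0} \<in> sets (S \<Otimes>\<^sub>M T)" if "z0 \<in> F" for z0
  proof -
    have "{fst z0} \<times> {snd z0} \<in> sets (S \<Otimes>\<^sub>M T)"
      using that SX TY by (intro pair_measureI) (auto simp: F_def)
    then show ?thesis by simp
  qed
  have fm[measurable]: "f \<in> borel_measurable (S \<Otimes>\<^sub>M T)"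
    by (subst f_eq) (intro borel_measurable_sum borel_measurable_times borel_measurable_const
        borel_measurable_indicator meas_sing)
  have f_nn: "0 \<le> f z" for z by (simp add: f_def)
  \<comment> \<open>Integrals against the marginals are pulled back to \<open>P\<close> and become
    finite sums over the supports, where the marginal masses are positive and cancel the denominator
    of \<open>f\<close>.\<close>
  have dens: "?DJ = density (?DX \<Otimes>\<^sub>M ?DY) f"
  proof (rule measure_eqI)
    show "sets ?DJ = sets (density (?DX \<Otimes>\<^sub>M ?DY) f)"
      by (simp cong: sets_pair_measure_cong)
    fix A assume "A \<in> sets ?DJ"
    then have A[measurable]: "A \<in> sets (S \<Otimes>\<^sub>M T)" by simp
    have "emeasure (density (?DX \<Otimes>\<^sub>M ?DY) f) A = (\<integral>\<^sup>+z. ennreal (f z) * indicator A z \<partial>(?DX \<Otimes>\<^sub>M ?DY))"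
      by (rule emeasure_density) (simp_all cong: measurable_cong_sets sets_pair_measure_cong)
    also have "\<dots> = (\<integral>\<^sup>+x. \<integral>\<^sup>+y. ennreal (f (x, y)) * indicator A (x, y) \<partial>?DY \<partial>?DX)"
      by (rule DY.nn_integral_fst[symmetric])
         (simp_all cong: measurable_cong_sets sets_pair_measure_cong)
    also have "\<dots> = (\<integral>\<^sup>+w. \<integral>\<^sup>+y. ennreal (f (X w, y)) * indicator A (X w, y) \<partial>?DY \<partial>P)"
    proof (rule nn_integral_distr[OF X])
      show "(\<lambda>x. \<integral>\<^sup>+y. ennreal (f (x, y)) * indicator A (x, y) \<partial>?DY) \<in> borel_measurable ?DX"
        by (rule DY.borel_measurable_nn_integral) (simp cong: measurable_cong_sets sets_pair_measure_cong)
    qed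
    also have "\<dots> = (\<integral>\<^sup>+w. \<integral>\<^sup>+w'. ennreal (f (X w, Y w')) * indicator A (X w, Y w') \<partial>P \<partial>P)"
    proof (intro nn_integral_cong nn_integral_distr[OF Y])
      fix w
      have [measurable]: "X w \<in> space S" using measurable_space[OF X] by simp
      show "(\<lambda>y. ennreal (f (X w, y)) * indicator A (X w, y)) \<in> borel_measurable ?DY"
        by simp
    qed
    also have "\<dots> = (\<integral>\<^sup>+x. \<integral>\<^sup>+y. ennreal (f (x, y)) * indicator A (x, y) \<partial>map_pmf Y P \<partial>map_pmf X P)"
      by simp
    also have "\<dots> = (\<Sum>x\<in>X ` set_pmf P. \<Sum>y\<in>Y ` set_pmf P.
        ennreal (f (x, y)) * indicator A (x, y) * pmf (map_pmf Y P) y * pmf (map_pmf X P) x)"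
      using fin by (simp add: nn_integral_measure_pmf_finite sum_distrib_right del: nn_integral_map_pmf)
    also have "\<dots> = (\<Sum>x\<in>X ` set_pmf P. \<Sum>y\<in>Y ` set_pmf P. ennreal (pmf J (x, y)) * indicator A (x, y))"
    proof (intro sum.cong refl)
      fix x y assume x: "x \<in> X ` set_pmf P" and y: "y \<in> Y ` set_pmf P"
      have "pmf (map_pmf X P) x > 0" "pmf (map_pmf Y P) y > 0"
        using x y by (auto simp: pmf_positive_iff)
      then have "pmf J (x, y) = f (x, y) * pmf (map_pmf Y P) y * pmf (map_pmf X P) x"
        by (simp add: f_def)
      then have "ennreal (pmf J (x, y)) = ennreal (f (x, y)) * pmf (map_pmf Y P) y * pmf (map_pmf X P) x"
        using f_nn by (simp add: ennreal_mult)
      then show "ennreal (f (x, y)) * indicator A (x, y) * pmf (map_pmf Y P) y * pmf (map_pmf X P) x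
          = ennreal (pmf J (x, y)) * indicator A (x, y)"
        by (simp add: mult_ac)
    qed
    also have "\<dots> = (\<Sum>z\<in>F. ennreal (pmf J z) * indicator A z)"
      by (simp add: F_def sum.cartesian_product case_prod_beta)
    also have "\<dots> = (\<Sum>z\<in>set_pmf J. ennreal (pmf J z) * indicator A z)"
    proof (rule sum.mono_neutral_right[OF finF])
      show "set_pmf J \<subseteq> F" by (auto simp: J_def F_def)
    qed (simp add: pmf_eq_0_set_pmf)
    also have "\<dots> = (\<integral>\<^sup>+z. indicator A z \<partial>J)"
    proof -
      have "finite (set_pmf J)" using fin by (simp add: J_def)
      then show ?thesis by (subst nn_integral_measure_pmf_finite) (simp_all add: mult.commute del: nn_integral_indicator)
    qed
    also have "\<dots> = (\<integral>\<^sup>+w. indicator A (X w, Y w) \<partial>P)"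
      by (simp add: J_def)
    also have "\<dots> = (\<integral>\<^sup>+z. indicator A z \<partial>?DJ)"
      by (rule nn_integral_distr[OF XY, symmetric]) simp
    also have "\<dots> = emeasure ?DJ A" by simp
    finally show "emeasure ?DJ A = emeasure (density (?DX \<Otimes>\<^sub>M ?DY) f) A" by simp
  qed
  have fm': "f \<in> borel_measurable (?DX \<Otimes>\<^sub>M ?DY)"
    by (simp cong: measurable_cong_sets sets_pair_measure_cong)
  have "prob_space.mutual_information (measure_pmf P) b S T X Y = KL_divergence b (?DX \<Otimes>\<^sub>M ?DY) (density (?DX \<Otimes>\<^sub>M ?DY) f)"
    unfolding prob_space.mutual_information_def[OF measure_pmf.prob_space_axioms] dens ..
  also have "\<dots> = (\<integral>z. f z * log b (f z) \<partial>(?DX \<Otimes>\<^sub>M ?DY))"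
    using fm' f_nn b by (intro D.KL_density) auto
  also have "\<dots> = (\<integral>z. log b (f z) \<partial>density (?DX \<Otimes>\<^sub>M ?DY) f)"
    using fm' f_nn by (subst integral_density) auto
  also have "\<dots> = (\<integral>z. log b (f z) \<partial>?DJ)" unfolding dens ..
  also have "\<dots> = (\<integral>w. log b (f (X w, Y w)) \<partial>P)"
    by (rule integral_distr[OF XY]) simp
  also have "\<dots> = (\<Sum>w\<in>set_pmf P. pmf P w * log b (f (X w, Y w)))"
    using fin by (subst integral_measure_pmf[of "set_pmf P"]) auto
  finally show ?thesis by (simp add: f_def J_def)
qed

text \<open>Only the draw \<open>x\<close> itself yields a pair with first component
  \<open>x\<close>, so the integral over \<open>q\<close> collapses to one term.\<close>

lemma pmf_bind_map_Pair:
  "pmf (bind_pmf q (\<lambda>x. map_pmf (Pair x) (K x))) (x, v) = pmf q x * pmf (K x) v"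
proof -
  have "pmf (map_pmf (Pair x') (K x')) (x, v) = indicator {x} x' * pmf (K x) v" for x'
  proof (cases "x' = x")
    case True
    then show ?thesis by (simp add: pmf_map_inj' inj_on_def)
  next
    case False
    then have "(x, v) \<notin> set_pmf (map_pmf (Pair x') (K x'))" by auto
    then show ?thesis using False by (simp add: set_pmf_iff del: set_map_pmf)
  qed
  then show ?thesis by (simp add: pmf_bind measure_pmf_single)
qed

text \<open>Projecting the joint law shows that \<open>q\<close> and \<open>r\<close> are the
  marginals; every logarithm on the support is then that of 1.\<close>

lemma MI_eq_0_pair_pmf:
  assumes fin: "finite (set_pmf P)" and J: "map_pmf (\<lambda>w. (X w, Y w)) P = pair_pmf q r"
  shows "MI P X Y = 0"
proof -
  have X: "map_pmf X P = q" and Y: "map_pmf Y P = r"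
    using arg_cong[OF J, of "map_pmf fst"] arg_cong[OF J, of "map_pmf snd"]
    by (simp_all add: map_pmf_comp map_fst_pair_pmf map_snd_pair_pmf)
  have "pmf q (X w) > 0" "pmf r (Y w) > 0" if "w \<in> set_pmf P" for w
    using that by (auto simp: pmf_positive_iff X[symmetric] Y[symmetric])
  then show ?thesis
    unfolding MI_def
    by (subst mutual_information_finite_pmf[OF fin]) (force simp: J X Y pmf_pair intro!: sum.neutral)+
qed

text \<open>The hypothesis says that \<open>f X\<close> determines the conditional law of \<open>Y\<close> given \<open>X\<close>.\<close>

lemma CMI_eq_0_kernel:
  assumes fin: "finite (set_pmf P)"
    and J: "map_pmf (\<lambda>w. (X w, Y w)) P = bind_pmf q (\<lambda>x. map_pmf (Pair x) (K (f x)))"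
  shows "CMI P X Y (\<lambda>w. f (X w)) = 0"
proof -
  let ?Z = "\<lambda>w. f (X w)"
  have X: "map_pmf X P = q"
    using arg_cong[OF J, of "map_pmf fst"] by (simp add: map_pmf_comp map_bind_pmf bind_return_pmf')
  have XYZ: "map_pmf (\<lambda>w. (X w, Y w, ?Z w)) P =
      bind_pmf q (\<lambda>x. map_pmf (Pair x) (map_pmf (\<lambda>y. (y, f x)) (K (f x))))"
    using arg_cong[OF J, of "map_pmf (\<lambda>(x, y). (x, y, f x))"]
    by (simp add: map_pmf_comp map_bind_pmf)
  have ZY: "map_pmf (\<lambda>w. (?Z w, Y w)) P = bind_pmf (map_pmf f q) (\<lambda>z. map_pmf (Pair z) (K z))"
    using arg_cong[OF J, of "map_pmf (\<lambda>(x, y). (f x, y))"]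
    by (simp add: map_pmf_comp map_bind_pmf bind_map_pmf)
  have Z: "map_pmf ?Z P = map_pmf f q"
    using arg_cong[OF X, of "map_pmf f"] by (simp add: map_pmf_comp)
  have XZ: "map_pmf (\<lambda>w. (X w, ?Z w)) P = map_pmf (\<lambda>x. (x, f x)) q"
    using arg_cong[OF X, of "map_pmf (\<lambda>x. (x, f x))"] by (simp add: map_pmf_comp)
  have p_XYZ: "pmf (map_pmf (\<lambda>w. (X w, Y w, ?Z w)) P) (x, y, f x) = pmf q x * pmf (K (f x)) y" for x y
    using pmf_map_inj'[of "\<lambda>y. (y, f x)" "K (f x)" y]
    by (simp add: XYZ pmf_bind_map_Pair inj_on_def)
  have p_YZ: "pmf (map_pmf (\<lambda>w. (Y w, ?Z w)) P) (y, z) = pmf (map_pmf f q) z * pmf (K z) y" for y z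
  proof -
    have "map_pmf (\<lambda>w. (Y w, ?Z w)) P = map_pmf prod.swap (map_pmf (\<lambda>w. (?Z w, Y w)) P)"
      by (simp add: map_pmf_comp)
    then have "pmf (map_pmf (\<lambda>w. (Y w, ?Z w)) P) (y, z) =
        pmf (map_pmf prod.swap (map_pmf (\<lambda>w. (?Z w, Y w)) P)) (prod.swap (z, y))"
      by simp
    also have "\<dots> = pmf (map_pmf (\<lambda>w. (?Z w, Y w)) P) (z, y)"
      by (rule pmf_map_inj') simp
    finally show ?thesis by (simp only: ZY pmf_bind_map_Pair)
  qed
  have p_XZ: "pmf (map_pmf (\<lambda>w. (X w, ?Z w)) P) (x, f x) = pmf q x" for x
    using pmf_map_inj'[of "\<lambda>x. (x, f x)" q x] by (simp add: XZ inj_on_def)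
  have K_pos: "pmf (K (f (X w))) (Y w) > 0" if "w \<in> set_pmf P" for w
  proof -
    have "pmf (map_pmf (\<lambda>w. (X w, Y w, ?Z w)) P) (X w, Y w, ?Z w) > 0"
      using that by (auto simp: pmf_positive_iff)
    then show ?thesis unfolding p_XYZ by (simp add: zero_less_mult_iff)
  qed
  have space: "space (measure_pmf P) = UNIV" by simp
  \<comment> \<open>Conditional mutual information is the difference of these two terms. On the
    support the conditional mass of \<open>Y\<close> is positive and cancels, leaving the same ratio
    in both.\<close>
  have "prob_space.mutual_information (measure_pmf P) 2 (count_space (range X))
      (count_space (range Y) \<Otimes>\<^sub>M count_space (range ?Z)) X (\<lambda>w. (Y w, ?Z w)) =
    prob_space.mutual_information (measure_pmf P) 2 (count_space (range X)) (count_space (range ?Z)) X ?Z"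
  proof (subst (1 2) mutual_information_finite_pmf[OF fin])
    fix w
    have "{Y w} \<times> {?Z w} \<in> sets (count_space (range Y) \<Otimes>\<^sub>M count_space (range ?Z))"
      by (intro pair_measureI) auto
    then show "{(Y w, ?Z w)} \<in> sets (count_space (range Y) \<Otimes>\<^sub>M count_space (range ?Z))" by simp
  next
    show "(\<lambda>w. (Y w, ?Z w)) \<in> measurable (measure_pmf P) (count_space (range Y) \<Otimes>\<^sub>M count_space (range ?Z))"
      by (intro measurable_Pair) auto
  qed (use K_pos in \<open>force simp: p_XYZ p_YZ p_XZ X Z intro!: sum.cong arg_cong[where f = "log 2"]\<close>)+
  then show ?thesis
    unfolding CMI_def prob_space.conditional_mutual_information_def[OF measure_pmf.prob_space_axioms] space
    by simp
qed

text \<open>An injective self-map of a finite set is a bijection and preserves the uniform law. Both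
  couplings below are instances, with \<open>T\<close> a translation of the noise.\<close>

lemma map_pmf_of_set_eq_if_inj:
  assumes "finite N" "N \<noteq> {}" "inj_on T N" "T ` N \<subseteq> N" "\<And>n. n \<in> N \<Longrightarrow> V n = V' (T n)"
  shows "map_pmf V (pmf_of_set N) = map_pmf V' (pmf_of_set N)"
proof -
  have "bij_betw T N N"
    using assms by (simp add: bij_betw_def endo_inj_surj)
  then have "map_pmf T (pmf_of_set N) = pmf_of_set N"
    using assms by (intro map_pmf_of_set_bij_betw) auto
  then have "map_pmf V' (pmf_of_set N) = map_pmf (\<lambda>n. V' (T n)) (pmf_of_set N)"
    by (metis map_pmf_comp)
  also have "\<dots> = map_pmf V (pmf_of_set N)"
    using assms by (intro map_pmf_cong) auto
  finally show ?thesis by simp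
qed

section \<open>Polynomials and partial fractions\<close>

text \<open>Newton's scheme: a new point is met by adding a multiple of the polynomial that vanishes
  on the old ones. Bounding coefficients instead of the degree also covers the empty set, where
  \<open>q\<close> must be 0.\<close>

lemma lagrange_interpolation_exists:
  fixes g :: "'a::field \<Rightarrow> 'a"
  assumes "finite A"
  shows "\<exists>q. (\<forall>i\<ge>card A. coeff q i = 0) \<and> (\<forall>a\<in>A. poly q a = g a)"
  using assms
proof (induction A)
  case empty
  then show ?case by (intro exI[of _ 0]) auto
next
  case (insert a A)
  then obtain q where q: "\<forall>i\<ge>card A. coeff q i = 0" "\<forall>a\<in>A. poly q a = g a" by auto
  define w where "w = (\<Prod>b\<in>A. [:-b, 1:])"
  have w_a: "poly w a \<noteq> 0" and w_A: "\<forall>b\<in>A. poly w b = 0"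
    using insert by (auto simp: w_def poly_prod)
  have deg_w: "degree w \<le> card A"
    unfolding w_def using degree_prod_sum_le[OF insert(1), of "\<lambda>b. [:-b, 1:]"] by simp
  let ?q = "q + smult ((g a - poly q a) / poly w a) w"
  show ?case
  proof (intro exI[of _ ?q] conjI allI ballI impI)
    fix i assume "card (insert a A) \<le> i"
    then have "card A < i" using insert by simp
    then show "coeff ?q i = 0" using q deg_w by (simp add: coeff_eq_0)
  next
    fix b assume "b \<in> insert a A"
    then show "poly ?q b = g b" using q w_a w_A by auto
  qed
qed

lemma poly_eq_sum_lessThan:
  fixes p :: "'a::comm_semiring_1 poly"
  assumes "\<And>i. i \<ge> n \<Longrightarrow> coeff p i = 0"
  shows "poly p x = (\<Sum>i<n. coeff p i * x ^ i)"
proof -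
  have "poly p x = (\<Sum>i\<le>degree p. coeff p i * x ^ i)" by (rule poly_altdef)
  also have "\<dots> = (\<Sum>i<max n (Suc (degree p)). coeff p i * x ^ i)"
    by (rule sum.mono_neutral_left) (auto simp: coeff_eq_0)
  also have "\<dots> = (\<Sum>i<n. coeff p i * x ^ i)"
    by (rule sum.mono_neutral_right) (auto simp: assms)
  finally show ?thesis .
qed

text \<open>After division by \<open>x ^ n\<close> the cutoff gives a polar part and the shift gives
  a polynomial.\<close>

lemma poly_cutoff_shift:
  "poly p x = poly (poly_cutoff n p) x + x ^ n * poly (poly_shift n p) x" for x :: "'a::comm_ring_1"
proof -
  have "p = poly_cutoff n p + monom 1 n * poly_shift n p"
    by (rule poly_eqI) (auto simp: coeff_poly_cutoff coeff_poly_shift coeff_monom_mult)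
  then have "poly p x = poly (poly_cutoff n p + monom 1 n * poly_shift n p) x" by simp
  then show ?thesis by (simp add: poly_monom)
qed

lemma poly_cutoff_mult_cong:
  assumes "poly_cutoff n p = poly_cutoff n q"
  shows "poly_cutoff n (r * p) = poly_cutoff n (r * q)"
proof -
  have *: "coeff p i = coeff q i" if "i < n" for i
    using arg_cong[OF assms, of "\<lambda>p. coeff p i"] that by (simp add: coeff_poly_cutoff)
  show ?thesis
    by (rule poly_eqI) (auto simp: coeff_poly_cutoff coeff_mult * intro!: sum.cong)
qed

text \<open>A polynomial with nonzero constant term is invertible modulo the \<open>n\<close>-th
  power of the variable; the induction solves for the coefficients in increasing order.\<close>

lemma poly_cutoff_mult_cancel:
  fixes r :: "'a::idom poly"
  assumes "poly_cutoff n (r * p) = poly_cutoff n (r * q)" "coeff r 0 \<noteq> 0" "i < n"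
  shows "coeff p i = coeff q i"
  using assms(3)
proof (induction i rule: less_induct)
  case (less i)
  have "(\<Sum>j\<le>i. coeff r j * coeff p (i - j)) = (\<Sum>j\<le>i. coeff r j * coeff q (i - j))"
    using arg_cong[OF assms(1), of "\<lambda>p. coeff p i"] less(2)
    by (simp add: coeff_poly_cutoff coeff_mult)
  moreover have "(\<Sum>j\<in>{1..i}. coeff r j * coeff p (i - j)) = (\<Sum>j\<in>{1..i}. coeff r j * coeff q (i - j))"
    by (rule sum.cong) (auto intro!: less.IH less_trans[OF _ less(2)])
  moreover have "{..i} = insert 0 {1..i}" by auto
  ultimately have "coeff r 0 * coeff p i = coeff r 0 * coeff q i" by simp
  then show ?case using assms(2) by simp
qed

lemma degree_prod_le_card:
  assumes "finite S" "\<And>i. i \<in> S \<Longrightarrow> degree (f i) \<le> n"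
  shows "degree (\<Prod>i\<in>S. f i) \<le> n * card S"
proof -
  have "degree (\<Prod>i\<in>S. f i) \<le> (\<Sum>i\<in>S. degree (f i))" using degree_prod_sum_le[OF assms(1)] by auto
  also have "\<dots> \<le> (\<Sum>i\<in>S. n)" by (rule sum_mono) (rule assms)
  finally show ?thesis by (simp add: mult.commute)
qed

lemma degree_root_factor_power_le: "degree ([:e, - 1:] ^ n) \<le> n" for e :: "'a::comm_ring_1"
  by (rule order_trans[OF degree_power_le]) simp

text \<open>Clearing denominators gives a polynomial \<open>H\<close> with more roots than its
  degree allows, so \<open>H = 0\<close>. All its summands except that of \<open>i\<close> are
  divisible by the \<open>n\<close>-th power of the factor at \<open>e i\<close>; hence so is the
  remaining one, which is too small to be divisible unless it is 0.\<close>

lemma partial_fractions_eq_0: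
  fixes e :: "'i \<Rightarrow> 'a::field"
  assumes I: "finite I" "inj_on e I"
    and T: "\<And>i. i \<in> I \<Longrightarrow> degree (T i) < n"
    and b: "degree b < N"
    and Pts: "finite Pts" "n * card I + N \<le> card Pts" "\<And>a i. a \<in> Pts \<Longrightarrow> i \<in> I \<Longrightarrow> e i \<noteq> a"
    and eq: "\<And>a. a \<in> Pts \<Longrightarrow> (\<Sum>i\<in>I. poly (T i) (e i - a) / (e i - a) ^ n) + poly b a = 0"
    and i: "i \<in> I"
  shows "T i = 0"
proof -
  define U where "U j = [:e j, - 1:] ^ n" for j
  define That where "That j = T j \<circ>\<^sub>p [:e j, - 1:]" for j
  define H where "H = (\<Sum>i\<in>I. That i * (\<Prod>j\<in>I - {i}. U j)) + b * (\<Prod>j\<in>I. U j)"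
  have poly_U: "poly (U j) a = (e j - a) ^ n" for j a by (simp add: U_def)
  have poly_That: "poly (That j) a = poly (T j) (e j - a)" for j a by (simp add: That_def poly_pcompose)
  have deg_U: "degree (U j) \<le> n" for j unfolding U_def by (rule degree_root_factor_power_le)
  have deg_That: "degree (That j) < n" if "j \<in> I" for j
    using T[OF that] by (simp add: That_def degree_pcompose)
  have "H = 0"
  proof (rule ccontr)
    assume "H \<noteq> 0"
    have cardI: "card I \<ge> 1" using I i by (simp add: card_gt_0_iff Suc_le_eq) blast
    have "degree H < n * card I + N"
      unfolding H_def
    proof (rule degree_add_less)
      show "degree (\<Sum>i\<in>I. That i * (\<Prod>j\<in>I - {i}. U j)) < n * card I + N"
      proof (rule le_less_trans[OF degree_sum_le[OF I(1), of _ "n * card I + N - 1"]])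
        fix j assume j: "j \<in> I"
        have "degree (That j * (\<Prod>j\<in>I - {j}. U j)) \<le> degree (That j) + n * (card I - 1)"
          using degree_prod_le_card[of "I - {j}" U n] I deg_U j
          by (intro order_trans[OF degree_mult_le]) auto
        also have "\<dots> \<le> n + n * (card I - 1) - 1" using deg_That[OF j] by simp
        also have "n + n * (card I - 1) = n * card I" using cardI by (cases "card I") auto
        finally show "degree (That j * (\<Prod>j\<in>I - {j}. U j)) \<le> n * card I + N - 1" by simp
      qed (use b in simp)
      have "degree (b * (\<Prod>j\<in>I. U j)) \<le> degree b + n * card I"
        using degree_prod_le_card[of I U n] I deg_U by (intro order_trans[OF degree_mult_le]) auto
      then show "degree (b * (\<Prod>j\<in>I. U j)) < n * card I + N" using b by simp
    qed
    moreover have "poly H a = 0" if a: "a \<in> Pts" for a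
    proof -
      have nz: "(e j - a) ^ n \<noteq> 0" if "j \<in> I" for j using Pts(3)[OF a that] by simp
      have D: "(\<Prod>j\<in>I - {j}. (e j - a) ^ n) = (\<Prod>j\<in>I. (e j - a) ^ n) / (e j - a) ^ n" if "j \<in> I" for j
        using prod.remove[OF I(1) that, of "\<lambda>j. (e j - a) ^ n"] nz[OF that] by simp
      have "poly H a = (\<Sum>j\<in>I. poly (T j) (e j - a) * (\<Prod>j\<in>I - {j}. (e j - a) ^ n))
          + poly b a * (\<Prod>j\<in>I. (e j - a) ^ n)"
        by (simp add: H_def poly_sum poly_prod poly_U poly_That)
      also have "\<dots> = (\<Prod>j\<in>I. (e j - a) ^ n) *
          ((\<Sum>j\<in>I. poly (T j) (e j - a) / (e j - a) ^ n) + poly b a)"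
        by (simp add: D sum_distrib_left distrib_left mult_ac cong: sum.cong)
      finally show ?thesis using eq[OF a] by simp
    qed
    then have "Pts \<subseteq> {a. poly H a = 0}" by auto
    then have "card Pts \<le> degree H"
      using poly_roots_finite[OF \<open>H \<noteq> 0\<close>] card_poly_roots_bound[OF \<open>H \<noteq> 0\<close>] card_mono by (meson order_trans)
    ultimately show False using Pts(2) by simp
  qed
  \<comment> \<open>\<open>order\<close> refers to the monic linear factor, so the sign is split off
    as a unit.\<close>
  have U_smult: "U j = smult ((-1) ^ n) ([:- e j, 1:] ^ n)" for j
  proof -
    have "[:e j, - 1:] = smult (-1) [:- e j, 1:]" by simp
    then show ?thesis unfolding U_def by (metis smult_power)
  qed
  have "U i dvd (\<Sum>i'\<in>I - {i}. That i' * (\<Prod>j\<in>I - {i'}. U j))"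
    using I i by (intro dvd_sum dvd_mult dvd_prodI) auto
  moreover have "U i dvd b * (\<Prod>j\<in>I. U j)"
    using I i by (intro dvd_mult dvd_prodI) auto
  moreover have That_eq: "That i * (\<Prod>j\<in>I - {i}. U j)
      = - (\<Sum>i'\<in>I - {i}. That i' * (\<Prod>j\<in>I - {i'}. U j)) - b * (\<Prod>j\<in>I. U j)"
    using \<open>H = 0\<close> sum.remove[OF I(1) i, of "\<lambda>i. That i * (\<Prod>j\<in>I - {i}. U j)"]
    by (simp add: H_def algebra_simps eq_neg_iff_add_eq_0)
  ultimately have "U i dvd That i * (\<Prod>j\<in>I - {i}. U j)"
    unfolding That_eq by (intro dvd_diff) simp_all
  then have dvd: "[:- e i, 1:] ^ n dvd That i * (\<Prod>j\<in>I - {i}. U j)"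
    by (simp add: U_smult smult_dvd_iff)
  \<comment> \<open>The cofactor does not vanish at \<open>e i\<close>, so the whole multiplicity
    \<open>n\<close> has to come from \<open>That i\<close>, whose degree is below
    \<open>n\<close>.\<close>
  have V: "poly (\<Prod>j\<in>I - {i}. U j) (e i) \<noteq> 0"
    using I i by (auto simp: poly_prod poly_U inj_on_def)
  have "That i = 0"
  proof (rule ccontr)
    assume nz: "That i \<noteq> 0"
    moreover have "(\<Prod>j\<in>I - {i}. U j) \<noteq> 0" using V by auto
    ultimately have nz': "That i * (\<Prod>j\<in>I - {i}. U j) \<noteq> 0" by simp
    have "n \<le> order (e i) (That i * (\<Prod>j\<in>I - {i}. U j))"
      using dvd nz' by (simp add: order_divides)
    also have "\<dots> = order (e i) (That i)"
      using V by (simp add: order_mult[OF nz'] order_0I)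
    also have "\<dots> \<le> degree (That i)" using nz by (rule order_degree)
    finally show False using deg_That[OF i] by simp
  qed
  then show ?thesis by (simp add: That_def pcompose_eq_0_iff)
qed

text \<open>The common factor clears one denominator, so after expansion only the diagonal terms
  keep a denominator \<open>u k\<close>. The grouping separates them from the terms with at most one
  noise factor and from the pure noise product \<open>za * zb\<close>.\<close>

lemma product_partial_fractions:
  fixes p q u :: "'k \<Rightarrow> 'a::field"
  assumes K: "finite K" and u: "\<And>k. k \<in> K \<Longrightarrow> u k \<noteq> 0"
  shows "(\<Prod>k\<in>K. u k) * ((\<Sum>k\<in>K. p k / u k) + za) * ((\<Sum>k\<in>K. q k / u k) + zb) =
    (\<Sum>k\<in>K. p k * q k * (\<Prod>k'\<in>K - {k}. u k') / u k)
    + ((\<Sum>k\<in>K. q k * ((\<Sum>k'\<in>K - {k}. p k' * (\<Prod>i\<in>K - {k} - {k'}. u i)) + (\<Prod>k'\<in>K - {k}. u k') * za))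
       + (\<Sum>k\<in>K. p k * (\<Prod>k'\<in>K - {k}. u k')) * zb)
    + (\<Prod>k\<in>K. u k) * za * zb"
proof -
  define D where "D = (\<Prod>k\<in>K. u k)"
  have V: "(\<Prod>k'\<in>K - {k}. u k') = D / u k" if "k \<in> K" for k
    using prod.remove[OF K that, of u] u[OF that] by (simp add: D_def)
  have W: "(\<Prod>i\<in>K - {k} - {k'}. u i) = D / u k / u k'" if "k \<in> K" "k' \<in> K - {k}" for k k'
    using prod.remove[of "K - {k}" k' u] that K u[of k'] by (simp add: V)
  \<comment> \<open>In the double sum the terms with \<open>k' = k\<close> form the diagonal; in the
    others \<open>D\<close> is divided by two distinct factors and stays a product.\<close>
  have *: "D * (\<Sum>k\<in>K. p k / u k) * (\<Sum>k\<in>K. q k / u k) =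
      (\<Sum>k\<in>K. p k * q k * (D / u k) / u k) + (\<Sum>k\<in>K. q k * (\<Sum>k'\<in>K - {k}. p k' * (D / u k / u k')))"
  proof -
    have "D * (\<Sum>k\<in>K. p k / u k) * (\<Sum>k\<in>K. q k / u k) = (\<Sum>k\<in>K. q k * (\<Sum>k'\<in>K. p k' * (D / u k / u k')))"
    proof -
      have "D * (\<Sum>k\<in>K. p k / u k) * (\<Sum>k\<in>K. q k / u k) = D * ((\<Sum>k\<in>K. q k / u k) * (\<Sum>k\<in>K. p k / u k))"
        by (simp only: mult_ac)
      also have "\<dots> = (\<Sum>k\<in>K. \<Sum>k'\<in>K. D * (q k / u k * (p k' / u k')))"
        by (subst sum_product) (simp only: sum_distrib_left)
      also have "\<dots> = (\<Sum>k\<in>K. \<Sum>k'\<in>K. q k * (p k' * (D / u k / u k')))"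
        by (intro sum.cong refl) simp
      finally show ?thesis by (simp only: sum_distrib_left)
    qed
    also have "\<dots> = (\<Sum>k\<in>K. p k * q k * (D / u k) / u k + q k * (\<Sum>k'\<in>K - {k}. p k' * (D / u k / u k')))"
      by (rule sum.cong[OF refl], subst sum.remove[OF K], assumption) (simp add: algebra_simps)
    finally show ?thesis by (simp add: sum.distrib)
  qed
  have "D * ((\<Sum>k\<in>K. p k / u k) + za) * ((\<Sum>k\<in>K. q k / u k) + zb) =
     D * (\<Sum>k\<in>K. p k / u k) * (\<Sum>k\<in>K. q k / u k)
     + D * za * (\<Sum>k\<in>K. q k / u k) + D * (\<Sum>k\<in>K. p k / u k) * zb + D * za * zb"
    by (simp add: algebra_simps)
  also have "D * za * (\<Sum>k\<in>K. q k / u k) = (\<Sum>k\<in>K. q k * (D / u k * za))"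
    by (simp add: sum_distrib_left mult_ac)
  finally have expand: "D * ((\<Sum>k\<in>K. p k / u k) + za) * ((\<Sum>k\<in>K. q k / u k) + zb) =
     D * (\<Sum>k\<in>K. p k / u k) * (\<Sum>k\<in>K. q k / u k)
     + (\<Sum>k\<in>K. q k * (D / u k * za)) + D * (\<Sum>k\<in>K. p k / u k) * zb + D * za * zb" .
  have cross: "(\<Sum>k\<in>K. q k * ((\<Sum>k'\<in>K - {k}. p k' * (\<Prod>i\<in>K - {k} - {k'}. u i)) + (\<Prod>k'\<in>K - {k}. u k') * za))
      = (\<Sum>k\<in>K. q k * (\<Sum>k'\<in>K - {k}. p k' * (D / u k / u k'))) + (\<Sum>k\<in>K. q k * (D / u k * za))"
    unfolding sum.distrib[symmetric] distrib_left[symmetric]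
    by (intro sum.cong refl arg_cong2[where f = "(*)"] arg_cong2[where f = "(+)"] V W)
  have diag: "(\<Sum>k\<in>K. p k * q k * (\<Prod>k'\<in>K - {k}. u k') / u k) = (\<Sum>k\<in>K. p k * q k * (D / u k) / u k)"
    and right: "(\<Sum>k\<in>K. p k * (\<Prod>k'\<in>K - {k}. u k')) = (\<Sum>k\<in>K. p k * (D / u k))"
    by (simp_all add: V cong: sum.cong)
  have left: "D * (\<Sum>k\<in>K. p k / u k) = (\<Sum>k\<in>K. p k * (D / u k))"
    by (simp add: sum_distrib_left mult_ac)
  show ?thesis
    unfolding cross diag right D_def[symmetric] expand left *[unfolded left] by (simp only: add_ac)
qed

lemma nat_div_mod_unique:
  fixes x y b q r :: nat
  assumes "x + b * q = y + b * r" "x < b" "y < b"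
  shows "x = y" "q = r"
proof -
  have "(x + b * q) mod b = x" "(y + b * r) mod b = y" "(x + b * q) div b = q" "(y + b * r) div b = r"
    using assms(2,3) by simp_all
  then show "x = y" "q = r" using assms(1) by metis+
qed

section \<open>Families of matrices\<close>

lemma degree_less_if_coeff_0:
  assumes "\<And>i. n \<le> i \<Longrightarrow> coeff p i = 0" "0 < n"
  shows "degree p < n"
  using assms by (metis degree_0 leading_coeff_0_iff not_le)

text \<open>Entrywise, the noise sums with weights \<open>galpha G s ^ (x - 1)\<close> are values of
  this polynomial at the server's point. With \<open>n = rho\<close> it also encodes the masks of a
  pole, in the local variable there.\<close>

definition polZ :: "nat \<Rightarrow> (nat \<Rightarrow> 'a::comm_semiring_1 mat) \<Rightarrow> nat \<Rightarrow> nat \<Rightarrow> 'a poly" where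
  "polZ n Z r c = (\<Sum>x\<in>{1..n}. monom (Z x $$ (r, c)) (x - 1))"

lemma coeff_polZ: "coeff (polZ n Z r c) i = (if i < n then Z (i + 1) $$ (r, c) else 0)"
proof -
  have "coeff (polZ n Z r c) i = (\<Sum>x\<in>{1..n}. if x = i + 1 then Z x $$ (r, c) else 0)"
    unfolding polZ_def coeff_sum coeff_monom by (rule sum.cong) auto
  then show ?thesis by (simp add: sum.delta)
qed

lemma poly_polZ: "poly (polZ n Z r c) a = (\<Sum>x\<in>{1..n}. a ^ (x - 1) * Z x $$ (r, c))"
  by (simp add: polZ_def poly_sum poly_monom mult.commute)

lemma degree_polZ: "degree (polZ n Z r c) \<le> n - 1"
  unfolding polZ_def
proof (rule degree_sum_le)
  fix x assume "x \<in> {1..n}"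
  then show "degree (monom (Z x $$ (r, c)) (x - 1)) \<le> n - 1"
    by (intro order_trans[OF degree_monom_le]) auto
qed simp

lemma msum_index: "i < r \<Longrightarrow> j < c \<Longrightarrow> msum r c I F $$ (i, j) = (\<Sum>x\<in>I. F x $$ (i, j))"
  by (simp add: msum_def)

lemma msum_dim [simp]: "dim_row (msum r c I F) = r" "dim_col (msum r c I F) = c"
  by (simp_all add: msum_def)

lemma smult_mat_index:
  "M \<in> carrier_mat r c \<Longrightarrow> i < r \<Longrightarrow> j < c \<Longrightarrow> (a \<cdot>\<^sub>m M) $$ (i, j) = a * M $$ (i, j)"
  by auto

text \<open>Restriction to \<open>I\<close> keeps the translated family in the extensional space
  \<open>PiE\<close>, so that the translation is a self-map of the noise space.\<close>

definition shift_mats :: "'i set \<Rightarrow> nat \<Rightarrow> nat \<Rightarrow> ('i \<Rightarrow> 'a::plus mat) \<Rightarrow> ('i \<Rightarrow> nat \<Rightarrow> nat \<Rightarrow> 'a) \<Rightarrow> 'i \<Rightarrow> 'a mat" where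
  "shift_mats I r c Z d = (\<lambda>x\<in>I. Matrix.mat r c (\<lambda>(i, j). Z x $$ (i, j) + d x i j))"

lemma shift_mats_PiE: "shift_mats I r c Z d \<in> PiE I (\<lambda>_. carrier_mat r c)"
  by (auto simp: shift_mats_def)

lemma shift_mats_index:
  "x \<in> I \<Longrightarrow> i < r \<Longrightarrow> j < c \<Longrightarrow> shift_mats I r c Z d x $$ (i, j) = Z x $$ (i, j) + d x i j"
  by (simp add: shift_mats_def)

lemma shift_mats_inj:
  fixes Z Z' :: "'i \<Rightarrow> 'a::group_add mat"
  assumes "Z \<in> PiE I (\<lambda>_. carrier_mat r c)" "Z' \<in> PiE I (\<lambda>_. carrier_mat r c)"
    and eq: "shift_mats I r c Z d = shift_mats I r c Z' d"
  shows "Z = Z'"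
proof (rule PiE_ext[OF assms(1,2)])
  fix x assume x: "x \<in> I"
  have Z: "Z x \<in> carrier_mat r c" "Z' x \<in> carrier_mat r c" using assms x by auto
  show "Z x = Z' x"
  proof (rule eq_matI)
    fix i j assume "i < dim_row (Z' x)" "j < dim_col (Z' x)"
    then have "i < r" "j < c" using Z by auto
    then show "Z x $$ (i, j) = Z' x $$ (i, j)"
      using fun_cong[OF eq, of x] shift_mats_index[OF x, of i r j c Z d] shift_mats_index[OF x, of i r j c Z' d]
      by simp
  qed (use Z in auto)
qed

lemma finite_carrier_mat: "finite (carrier_mat r c :: 'a::finite mat set)"
proof (rule finite_subset)
  show "carrier_mat r c \<subseteq> (\<lambda>f. Matrix.mat r c f) ` (PiE ({..<r} \<times> {..<c}) (\<lambda>_. UNIV :: 'a set))"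
  proof
    fix M :: "'a mat" assume M: "M \<in> carrier_mat r c"
    have "M = Matrix.mat r c (restrict (\<lambda>x. M $$ x) ({..<r} \<times> {..<c}))"
      using M by (intro eq_matI) simp_all
    then show "M \<in> (\<lambda>f. Matrix.mat r c f) ` (PiE ({..<r} \<times> {..<c}) (\<lambda>_. UNIV :: 'a set))"
      by (intro image_eqI[where x = "restrict (\<lambda>x. M $$ x) ({..<r} \<times> {..<c})"]) simp_all
  qed
qed (intro finite_imageI finite_PiE, auto)

lemma pmf_of_set_Times:
  assumes "finite A" "A \<noteq> {}" "finite B" "B \<noteq> {}"
  shows "pmf_of_set (A \<times> B) = pair_pmf (pmf_of_set A) (pmf_of_set B)"
proof (rule pmf_eqI)
  fix x show "pmf (pmf_of_set (A \<times> B)) x = pmf (pair_pmf (pmf_of_set A) (pmf_of_set B)) x"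
    using assms by (cases x) (simp add: pmf_pair card_cartesian_product indicator_def)
qed

text \<open>The decoder returns the value of \<open>g\<close> at any outcome with the observed value
  of \<open>f\<close>; the hypothesis makes the choice immaterial.\<close>

lemma decoder_exists:
  assumes "\<And>w w'. w \<in> \<Omega> \<Longrightarrow> w' \<in> \<Omega> \<Longrightarrow> f w = f w' \<Longrightarrow> g w = g w'"
  shows "\<exists>dec. \<forall>w\<in>\<Omega>. dec (f w) = g w"
proof (intro exI[of _ "\<lambda>y. g (SOME w. w \<in> \<Omega> \<and> f w = y)"] ballI)
  fix w assume w: "w \<in> \<Omega>"
  have "(SOME w'. w' \<in> \<Omega> \<and> f w' = f w) \<in> \<Omega> \<and> f (SOME w'. w' \<in> \<Omega> \<and> f w' = f w) = f w"
    by (rule someI[of "\<lambda>w'. w' \<in> \<Omega> \<and> f w' = f w"]) (use w in simp)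
  then show "g (SOME w'. w' \<in> \<Omega> \<and> f w' = f w) = g w"
    using assms[of _ w] w by blast
qed

section \<open>The answers as rational functions\<close>

locale gcsa =
  fixes G :: "'a::{field,finite} gparams"
  assumes pos: "gS G > 0" "gX G > 0" "gell G > 0" "gKc G > 0" "gp G > 0" "gm G > 0" "gn G > 0"
      "glam G > 0" "gkap G > 0" "gmu G > 0"
    and dvd: "gm G dvd glam G" "gp G dvd gkap G" "gn G dvd gmu G"
    and dist_alpha: "inj_on (galpha G) {1..gS G}"
    and dist_f: "inj_on (\<lambda>(l, k). gf G l k) ({1..gell G} \<times> {1..gKc G})"
    and dist_af: "\<forall>s\<in>{1..gS G}. \<forall>l\<in>{1..gell G}. \<forall>k\<in>{1..gKc G}. galpha G s \<noteq> gf G l k"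
begin

abbreviation "rho \<equiv> gR' G"
abbreviation "Ks \<equiv> {1..gKc G}"
abbreviation "Ls \<equiv> {1..gell G}"
abbreviation "lin l k \<equiv> [:gf G l k, - 1:]"
abbreviation "fac l k \<equiv> [:gf G l k, - 1:] ^ rho"

text \<open>Entries of \<open>P\<close>, \<open>Q\<close> and \<open>P Q\<close> as polynomials in the local variable \<open>t = f_{l,k} - \<alpha>\<close>;
  composition with \<open>lin l k\<close> passes to the variable \<open>\<alpha>\<close>.\<close>

definition polA :: "(nat \<Rightarrow> 'a mat) \<Rightarrow> nat \<Rightarrow> nat \<Rightarrow> nat \<Rightarrow> nat \<Rightarrow> 'a poly" where
  "polA A l k r j = (\<Sum>(m', p')\<in>{1..gm G} \<times> {1..gp G}.
     monom (blkA G (A (gKc G * (l - 1) + k)) m' p' $$ (r, j)) (p' - 1 + gp G * (m' - 1)))"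

definition polB :: "(nat \<Rightarrow> 'a mat) \<Rightarrow> nat \<Rightarrow> nat \<Rightarrow> nat \<Rightarrow> nat \<Rightarrow> 'a poly" where
  "polB B l k j c = (\<Sum>(p'', n'')\<in>{1..gp G} \<times> {1..gn G}.
     monom (blkB G (B (gKc G * (l - 1) + k)) p'' n'' $$ (j, c)) (gp G - p'' + gp G * gm G * (n'' - 1)))"

definition polAB :: "(nat \<Rightarrow> 'a mat) \<Rightarrow> (nat \<Rightarrow> 'a mat) \<Rightarrow> nat \<Rightarrow> nat \<Rightarrow> nat \<Rightarrow> nat \<Rightarrow> 'a poly" where
  "polAB A B l k r c = (\<Sum>j<cA G. polA A l k r j * polB B l k j c)"

text \<open>At \<open>gf G l k - galpha G s\<close> this is \<open>Delta G s l\<close> without the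
  factor of \<open>k\<close>: the cofactor left at the pole when \<open>Delta\<close> clears
  denominators.\<close>

definition psi :: "nat \<Rightarrow> nat \<Rightarrow> 'a poly" where
  "psi l k = (\<Prod>k'\<in>Ks - {k}. [:gf G l k' - gf G l k, 1:] ^ rho)"

definition polZA :: "'a noise \<Rightarrow> nat \<Rightarrow> nat \<Rightarrow> nat \<Rightarrow> 'a poly" where
  "polZA z l = polZ (gX G) (\<lambda>x. nZA z (l, x))"

definition polZB :: "'a noise \<Rightarrow> nat \<Rightarrow> nat \<Rightarrow> nat \<Rightarrow> 'a poly" where
  "polZB z l = polZ (gX G) (\<lambda>x. nZB z (l, x))"

text \<open>\<open>Z2\<close> only reads the noise component of an outcome, so the inputs may be arbitrary.\<close>

definition polZ2 :: "'a noise \<Rightarrow> nat \<Rightarrow> nat \<Rightarrow> nat \<Rightarrow> nat \<Rightarrow> 'a poly" where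
  "polZ2 z l k = polZ rho (Z2 G (undefined, undefined, z) l k)"

text \<open>The middle group of \<open>product_partial_fractions\<close> at row \<open>r\<close>,
  column \<open>c\<close> and inner index \<open>j\<close>: products of data belonging to different
  poles, and products of data with the noise of one source.\<close>

definition cross :: "(nat \<Rightarrow> 'a mat) \<Rightarrow> (nat \<Rightarrow> 'a mat) \<Rightarrow> 'a noise \<Rightarrow> nat \<Rightarrow> nat \<Rightarrow> nat \<Rightarrow> nat \<Rightarrow> 'a poly" where
  "cross A B z l r c j =
     (\<Sum>k\<in>Ks. (polB B l k j c \<circ>\<^sub>p lin l k) *
        ((\<Sum>k'\<in>Ks - {k}. (polA A l k' r j \<circ>\<^sub>p lin l k') * (\<Prod>i\<in>Ks - {k} - {k'}. fac l i))
         + (\<Prod>k'\<in>Ks - {k}. fac l k') * polZA z l r j))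
     + (\<Sum>k\<in>Ks. (polA A l k r j \<circ>\<^sub>p lin l k) * (\<Prod>k'\<in>Ks - {k}. fac l k')) * polZB z l j c"

text \<open>The regular part of an answer entry is \<open>low_part + top_part\<close> plus the \<open>Z'\<close> polynomial. Only
  \<open>low_part\<close> involves the inputs, and its degree is small enough to be masked by \<open>Z'\<close>.\<close>

definition low_part :: "(nat \<Rightarrow> 'a mat) \<Rightarrow> (nat \<Rightarrow> 'a mat) \<Rightarrow> 'a noise \<Rightarrow> nat \<Rightarrow> nat \<Rightarrow> 'a poly" where
  "low_part A B z r c = (\<Sum>l\<in>Ls. (\<Sum>k\<in>Ks. poly_shift rho (psi l k * polAB A B l k r c) \<circ>\<^sub>p lin l k)
     + (\<Sum>j<cA G. cross A B z l r c j))"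

definition top_part :: "'a noise \<Rightarrow> nat \<Rightarrow> nat \<Rightarrow> 'a poly" where
  "top_part z r c = (\<Sum>l\<in>Ls. \<Sum>j<cA G. (\<Prod>k\<in>Ks. fac l k) * polZA z l r j * polZB z l j c)"

definition pole :: "(nat \<Rightarrow> 'a mat) \<Rightarrow> (nat \<Rightarrow> 'a mat) \<Rightarrow> 'a noise \<Rightarrow> nat \<Rightarrow> nat \<Rightarrow> nat \<Rightarrow> nat \<Rightarrow> 'a poly" where
  "pole A B z l k r c = poly_cutoff rho (psi l k * (polAB A B l k r c + polZ2 z l k r c))"

section \<open>Entrywise formulas for shares, messages and answers\<close>

lemma f_minus_alpha: "s \<in> {1..gS G} \<Longrightarrow> l \<in> Ls \<Longrightarrow> k \<in> Ks \<Longrightarrow> gf G l k - galpha G s \<noteq> 0"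
  using dist_af by force

lemma poly_psi: "poly (psi l k) (gf G l k - a) = (\<Prod>k'\<in>Ks - {k}. (gf G l k' - a) ^ rho)"
  by (simp add: psi_def poly_prod)

lemma coeff_psi: "coeff (psi l k) i = cc G l k i"
  by (simp add: psi_def cc_def)

lemma noise_carrier:
  assumes "z \<in> NoiseSpace G"
  shows "l \<in> Ls \<Longrightarrow> x \<in> {1..gX G} \<Longrightarrow> nZA z (l, x) \<in> carrier_mat (rA G) (cA G)"
    and "l \<in> Ls \<Longrightarrow> x \<in> {1..gX G} \<Longrightarrow> nZB z (l, x) \<in> carrier_mat (cA G) (cB G)"
    and "x \<in> {1..NZ1 G} \<Longrightarrow> nZ1 z x \<in> carrier_mat (rA G) (cB G)"
    and "l \<in> Ls \<Longrightarrow> k \<in> Ks \<Longrightarrow> i \<in> {1..rho} \<Longrightarrow> Z2 G (A, B, z) l k i \<in> carrier_mat (rA G) (cB G)"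
  using assms by (auto simp: NoiseSpace_def Z2_def oN_def PiE_iff)

lemma PP_index:
  assumes "r < rA G" "j < cA G"
  shows "PP G (A, B, z) s l k $$ (r, j) = poly (polA A l k r j) (gf G l k - galpha G s)"
  using assms unfolding PP_def
  by (subst msum_index) (auto simp: polA_def poly_sum poly_monom oA_def blkA_def intro!: sum.cong)

lemma QQ_index:
  assumes "r < cA G" "j < cB G"
  shows "QQ G (A, B, z) s l k $$ (r, j) = poly (polB B l k r j) (gf G l k - galpha G s)"
  using assms unfolding QQ_def
  by (subst msum_index) (auto simp: polB_def poly_sum poly_monom oB_def blkB_def intro!: sum.cong)

lemma QQ_dim [simp]: "dim_row (QQ G w s l k) = cA G" "dim_col (QQ G w s l k) = cB G"
  by (simp_all add: QQ_def)

lemma PP_dim [simp]: "dim_row (PP G w s l k) = rA G" "dim_col (PP G w s l k) = cA G"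
  by (simp_all add: PP_def)

lemma At_dim [simp]: "dim_row (At G w s l) = rA G" "dim_col (At G w s l) = cA G"
  by (simp_all add: At_def)

lemma Bt_dim [simp]: "dim_row (Bt G w s l) = cA G" "dim_col (Bt G w s l) = cB G"
  by (simp_all add: Bt_def)

lemma Mt_dim [simp]: "dim_row (Mt G w s) = rA G" "dim_col (Mt G w s) = cB G"
  by (simp_all add: Mt_def)

lemma Yans_dim [simp]: "dim_row (Yans G w s) = rA G" "dim_col (Yans G w s) = cB G"
  by (simp_all add: Yans_def)

lemma At_index:
  assumes z: "z \<in> NoiseSpace G" "l \<in> Ls" and rj: "r < rA G" "j < cA G"
  shows "At G (A, B, z) s l $$ (r, j) = Delta G s l *
    ((\<Sum>k\<in>Ks. poly (polA A l k r j) (gf G l k - galpha G s) / (gf G l k - galpha G s) ^ rho)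
     + poly (polZA z l r j) (galpha G s))"
proof -
  have "(\<Sum>x\<in>{1..gX G}. (galpha G s ^ (x - 1) \<cdot>\<^sub>m nZA z (l, x)) $$ (r, j)) = poly (polZA z l r j) (galpha G s)"
    unfolding polZA_def poly_polZ
    by (intro sum.cong refl smult_mat_index[OF noise_carrier(1)[OF z]] rj)
  then show ?thesis
    using rj by (simp add: At_def msum_index PP_index oN_def)
qed

lemma Bt_index:
  assumes z: "z \<in> NoiseSpace G" "l \<in> Ls" and rj: "r < cA G" "j < cB G"
  shows "Bt G (A, B, z) s l $$ (r, j) =
    (\<Sum>k\<in>Ks. poly (polB B l k r j) (gf G l k - galpha G s) / (gf G l k - galpha G s) ^ rho)
     + poly (polZB z l r j) (galpha G s)"
proof -
  have "(\<Sum>x\<in>{1..gX G}. (galpha G s ^ (x - 1) \<cdot>\<^sub>m nZB z (l, x)) $$ (r, j)) = poly (polZB z l r j) (galpha G s)"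
    unfolding polZB_def poly_polZ
    by (intro sum.cong refl smult_mat_index[OF noise_carrier(2)[OF z]] rj)
  then show ?thesis
    using rj by (simp add: Bt_def msum_index QQ_index oN_def)
qed

text \<open>The inner sum over \<open>i'\<close> is the convolution giving coefficient
  \<open>i\<close> of \<open>psi * polZ2\<close>, and \<open>i\<close> stops below
  \<open>rho\<close>. The double sum is thus the truncated product divided by the power
  \<open>rho\<close> of the local variable.\<close>

lemma Mt_index:
  assumes z: "z \<in> NoiseSpace G" and rc: "r < rA G" "c < cB G"
    and s: "s \<in> {1..gS G}"
  shows "Mt G (A, B, z) s $$ (r, c) = poly (polZ (NZ1 G) (nZ1 z) r c) (galpha G s) +
    (\<Sum>l\<in>Ls. \<Sum>k\<in>Ks. poly (poly_cutoff rho (psi l k * polZ2 z l k r c)) (gf G l k - galpha G s)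
        / (gf G l k - galpha G s) ^ rho)"
proof -
  have 1: "(\<Sum>x\<in>{1..NZ1 G}. (galpha G s ^ (x - 1) \<cdot>\<^sub>m nZ1 z x) $$ (r, c)) = poly (polZ (NZ1 G) (nZ1 z) r c) (galpha G s)"
    unfolding poly_polZ
    by (intro sum.cong refl smult_mat_index[OF noise_carrier(3)[OF z]] rc)
  have 2: "(\<Sum>i\<in>{0..<rho}. ((1 / (gf G l k - galpha G s) ^ (rho - i)) \<cdot>\<^sub>m
           msum (rA G) (cB G) {0..i} (\<lambda>i'. cc G l k (i - i') \<cdot>\<^sub>m Z2 G (A, B, z) l k (i' + 1))) $$ (r, c)) =
      poly (poly_cutoff rho (psi l k * polZ2 z l k r c)) (gf G l k - galpha G s)
        / (gf G l k - galpha G s) ^ rho" if lk: "l \<in> Ls" "k \<in> Ks" for l k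
  proof -
    let ?u = "gf G l k - galpha G s"
    have u: "?u \<noteq> 0" using f_minus_alpha s lk by simp
    have "poly (poly_cutoff rho (psi l k * polZ2 z l k r c)) ?u / ?u ^ rho
        = (\<Sum>i<rho. coeff (psi l k * polZ2 z l k r c) i * ?u ^ i) / ?u ^ rho"
      by (subst poly_eq_sum_lessThan[of rho]) (auto simp: coeff_poly_cutoff)
    also have "\<dots> = (\<Sum>i<rho. coeff (polZ2 z l k r c * psi l k) i / ?u ^ (rho - i))"
      unfolding sum_divide_distrib using u
      by (intro sum.cong refl) (simp add: power_diff mult.commute)
    also have "\<dots> = (\<Sum>i\<in>{0..<rho}. ((1 / ?u ^ (rho - i)) \<cdot>\<^sub>m
           msum (rA G) (cB G) {0..i} (\<lambda>i'. cc G l k (i - i') \<cdot>\<^sub>m Z2 G (A, B, z) l k (i' + 1))) $$ (r, c))"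
    proof (rule sum.cong)
      fix i assume i: "i \<in> {0..<rho}"
      have "coeff (polZ2 z l k r c * psi l k) i = (\<Sum>i'\<in>{0..i}. Z2 G (A, B, z) l k (i' + 1) $$ (r, c) * cc G l k (i - i'))"
        unfolding coeff_mult using i
        by (intro sum.cong) (auto simp: polZ2_def coeff_polZ coeff_psi Z2_def oN_def)
      also have "\<dots> = (\<Sum>i'\<in>{0..i}. (cc G l k (i - i') \<cdot>\<^sub>m Z2 G (A, B, z) l k (i' + 1)) $$ (r, c))"
      proof (rule sum.cong)
        fix i' assume "i' \<in> {0..i}"
        then have "Z2 G (A, B, z) l k (i' + 1) \<in> carrier_mat (rA G) (cB G)"
          using i noise_carrier(4)[OF z lk] by auto
        then show "Z2 G (A, B, z) l k (i' + 1) $$ (r, c) * cc G l k (i - i') =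
            (cc G l k (i - i') \<cdot>\<^sub>m Z2 G (A, B, z) l k (i' + 1)) $$ (r, c)"
          using rc by (simp add: smult_mat_index mult.commute)
      qed simp
      finally show "coeff (polZ2 z l k r c * psi l k) i / ?u ^ (rho - i) = ((1 / ?u ^ (rho - i)) \<cdot>\<^sub>m
           msum (rA G) (cB G) {0..i} (\<lambda>i'. cc G l k (i - i') \<cdot>\<^sub>m Z2 G (A, B, z) l k (i' + 1))) $$ (r, c)"
        using rc by (simp add: msum_index)
    qed auto
    finally show ?thesis ..
  qed
  have "Mt G (A, B, z) s $$ (r, c) = (\<Sum>x\<in>{1..NZ1 G}. (galpha G s ^ (x - 1) \<cdot>\<^sub>m nZ1 z x) $$ (r, c)) +
     (\<Sum>l\<in>Ls. \<Sum>k\<in>Ks. \<Sum>i\<in>{0..<rho}. ((1 / (gf G l k - galpha G s) ^ (rho - i)) \<cdot>\<^sub>m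
           msum (rA G) (cB G) {0..i} (\<lambda>i'. cc G l k (i - i') \<cdot>\<^sub>m Z2 G (A, B, z) l k (i' + 1))) $$ (r, c))"
    unfolding sum.cartesian_product
    using rc by (simp add: Mt_def msum_index oN_def split_def)
  then show ?thesis unfolding 1 by (simp only: 2 cong: sum.cong)
qed

text \<open>Summing the diagonal terms of \<open>product_partial_fractions\<close> over the inner
  index \<open>j\<close> produces \<open>psi * polAB\<close> over the power \<open>rho\<close> of
  the local variable, which \<open>poly_cutoff_shift\<close> splits into a polar and a regular
  part.\<close>

lemma share_product_index:
  assumes z: "z \<in> NoiseSpace G" and l: "l \<in> Ls" and rc: "r < rA G" "c < cB G"
    and s: "s \<in> {1..gS G}"
  shows "(At G (A, B, z) s l * Bt G (A, B, z) s l) $$ (r, c) =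
    (\<Sum>k\<in>Ks. poly (poly_cutoff rho (psi l k * polAB A B l k r c)) (gf G l k - galpha G s)
        / (gf G l k - galpha G s) ^ rho)
    + poly (\<Sum>k\<in>Ks. poly_shift rho (psi l k * polAB A B l k r c) \<circ>\<^sub>p lin l k) (galpha G s)
    + poly (\<Sum>j<cA G. cross A B z l r c j) (galpha G s)
    + poly (\<Sum>j<cA G. (\<Prod>k\<in>Ks. fac l k) * polZA z l r j * polZB z l j c) (galpha G s)"
proof -
  define a where "a = galpha G s"
  define u where "u k = gf G l k - a" for k
  have u: "u k ^ rho \<noteq> 0" if "k \<in> Ks" for k using f_minus_alpha s l that by (simp add: u_def a_def)
  have fac: "poly (fac l k) a = u k ^ rho" for k by (simp add: u_def)
  have entry: "At G (A, B, z) s l $$ (r, j) * Bt G (A, B, z) s l $$ (j, c) =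
      (\<Sum>k\<in>Ks. poly (polA A l k r j) (u k) * poly (polB B l k j c) (u k) * (\<Prod>k'\<in>Ks - {k}. u k' ^ rho) / u k ^ rho)
      + poly (cross A B z l r c j) a
      + poly ((\<Prod>k\<in>Ks. fac l k) * polZA z l r j * polZB z l j c) a" if j: "j < cA G" for j
  proof -
    have "At G (A, B, z) s l $$ (r, j) * Bt G (A, B, z) s l $$ (j, c) =
      (\<Prod>k\<in>Ks. u k ^ rho) * ((\<Sum>k\<in>Ks. poly (polA A l k r j) (u k) / u k ^ rho) + poly (polZA z l r j) a)
        * ((\<Sum>k\<in>Ks. poly (polB B l k j c) (u k) / u k ^ rho) + poly (polZB z l j c) a)"
      using At_index[OF z l rc(1) j] Bt_index[OF z l j rc(2)] by (simp add: Delta_def u_def a_def)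
    also have "\<dots> = (\<Sum>k\<in>Ks. poly (polA A l k r j) (u k) * poly (polB B l k j c) (u k) * (\<Prod>k'\<in>Ks - {k}. u k' ^ rho) / u k ^ rho)
      + poly (cross A B z l r c j) a
      + poly ((\<Prod>k\<in>Ks. fac l k) * polZA z l r j * polZB z l j c) a"
      by (subst product_partial_fractions) (use u in \<open>simp_all add: cross_def poly_sum poly_prod poly_pcompose fac u_def\<close>)
    finally show ?thesis .
  qed
  have pole: "(\<Sum>j<cA G. \<Sum>k\<in>Ks. poly (polA A l k r j) (u k) * poly (polB B l k j c) (u k) * (\<Prod>k'\<in>Ks - {k}. u k' ^ rho) / u k ^ rho)
      = (\<Sum>k\<in>Ks. poly (poly_cutoff rho (psi l k * polAB A B l k r c)) (u k) / u k ^ rho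
          + poly (poly_shift rho (psi l k * polAB A B l k r c)) (u k))"
  proof (subst sum.swap, rule sum.cong[OF refl])
    fix k assume k: "k \<in> Ks"
    have "(\<Sum>j<cA G. poly (polA A l k r j) (u k) * poly (polB B l k j c) (u k) * (\<Prod>k'\<in>Ks - {k}. u k' ^ rho) / u k ^ rho)
        = poly (psi l k * polAB A B l k r c) (u k) / u k ^ rho"
      by (simp add: polAB_def poly_sum sum_distrib_left sum_divide_distrib poly_psi[of l k a, folded u_def] mult.commute)
    also have "\<dots> = poly (poly_cutoff rho (psi l k * polAB A B l k r c)) (u k) / u k ^ rho
          + poly (poly_shift rho (psi l k * polAB A B l k r c)) (u k)"
      using u[OF k] by (subst poly_cutoff_shift[of _ _ rho]) (simp add: add_divide_distrib)
    finally show "(\<Sum>j<cA G. poly (polA A l k r j) (u k) * poly (polB B l k j c) (u k) * (\<Prod>k'\<in>Ks - {k}. u k' ^ rho) / u k ^ rho) = \<dots>" .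
  qed
  have "(At G (A, B, z) s l * Bt G (A, B, z) s l) $$ (r, c) =
      (\<Sum>j<cA G. At G (A, B, z) s l $$ (r, j) * Bt G (A, B, z) s l $$ (j, c))"
    using rc by (simp add: times_mat_def scalar_prod_def atLeast0LessThan)
  also have "\<dots> = (\<Sum>j<cA G. (\<Sum>k\<in>Ks. poly (polA A l k r j) (u k) * poly (polB B l k j c) (u k) * (\<Prod>k'\<in>Ks - {k}. u k' ^ rho) / u k ^ rho)
      + poly (cross A B z l r c j) a
      + poly ((\<Prod>k\<in>Ks. fac l k) * polZA z l r j * polZB z l j c) a)"
    by (rule sum.cong) (auto simp: entry)
  also have "\<dots> = (\<Sum>k\<in>Ks. poly (poly_cutoff rho (psi l k * polAB A B l k r c)) (u k) / u k ^ rho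
          + poly (poly_shift rho (psi l k * polAB A B l k r c)) (u k))
      + (\<Sum>j<cA G. poly (cross A B z l r c j) a)
      + (\<Sum>j<cA G. poly ((\<Prod>k\<in>Ks. fac l k) * polZA z l r j * polZB z l j c) a)"
    unfolding sum.distrib pole ..
  finally show ?thesis
    by (simp add: poly_sum sum.distrib poly_pcompose u_def a_def)
qed

text \<open>Truncation is additive, so the polar parts of the share products and of the server mask
  merge into \<open>pole\<close>. Recoverability and privacy both rest on this form of an
  answer.\<close>

lemma Yans_index:
  assumes z: "z \<in> NoiseSpace G" and rc: "r < rA G" "c < cB G" and s: "s \<in> {1..gS G}"
  shows "Yans G (A, B, z) s $$ (r, c) =
    (\<Sum>(l, k)\<in>Ls \<times> Ks. poly (pole A B z l k r c) (gf G l k - galpha G s) / (gf G l k - galpha G s) ^ rho)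
    + poly (low_part A B z r c + top_part z r c + polZ (NZ1 G) (nZ1 z) r c) (galpha G s)"
proof -
  have cut_add: "poly_cutoff rho (p + q) = poly_cutoff rho p + poly_cutoff rho q" for p q :: "'a poly"
    by (rule poly_eqI) (simp add: coeff_poly_cutoff)
  have "Yans G (A, B, z) s $$ (r, c) =
      (\<Sum>l\<in>Ls. (At G (A, B, z) s l * Bt G (A, B, z) s l) $$ (r, c)) + Mt G (A, B, z) s $$ (r, c)"
    using rc by (simp add: Yans_def msum_index)
  also have "(\<Sum>l\<in>Ls. (At G (A, B, z) s l * Bt G (A, B, z) s l) $$ (r, c)) = (\<Sum>l\<in>Ls.
      (\<Sum>k\<in>Ks. poly (poly_cutoff rho (psi l k * polAB A B l k r c)) (gf G l k - galpha G s)
          / (gf G l k - galpha G s) ^ rho)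
      + poly (\<Sum>k\<in>Ks. poly_shift rho (psi l k * polAB A B l k r c) \<circ>\<^sub>p lin l k) (galpha G s)
      + poly (\<Sum>j<cA G. cross A B z l r c j) (galpha G s)
      + poly (\<Sum>j<cA G. (\<Prod>k\<in>Ks. fac l k) * polZA z l r j * polZB z l j c) (galpha G s))"
    by (intro sum.cong refl share_product_index z rc s)
  finally show ?thesis
    unfolding Mt_index[OF z rc s]
    by (simp add: low_part_def top_part_def pole_def sum.cartesian_product[symmetric]
        sum.distrib poly_sum distrib_left cut_add add_divide_distrib)
qed

subsection \<open>Degree bounds\<close>

lemma rho_pos: "0 < rho"
  using pos by (simp add: gR'_def)

lemma degree_polA: "degree (polA A l k r j) \<le> gp G * gm G - 1"
  unfolding polA_def
proof (rule degree_sum_le, simp, clarify)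
  \<comment> \<open>The products are abstracted to variables, so only linear arithmetic with
    truncated subtraction remains.\<close>
  have aux: "1 \<le> i \<Longrightarrow> i \<le> P \<Longrightarrow> P + x \<le> y \<Longrightarrow> i - 1 + x \<le> y - 1" for i P x y :: nat by simp
  fix m' p' assume *: "m' \<in> {1..gm G}" "p' \<in> {1..gp G}"
  have "gp G + gp G * (m' - 1) = gp G * m'" using * by (cases m') auto
  moreover have "gp G * m' \<le> gp G * gm G" using * by simp
  ultimately have "p' - 1 + gp G * (m' - 1) \<le> gp G * gm G - 1"
    using aux[of p' "gp G" "gp G * (m' - 1)" "gp G * gm G"] * by auto
  then show "degree (monom (blkA G (A (gKc G * (l - 1) + k)) m' p' $$ (r, j)) (p' - 1 + gp G * (m' - 1)))
      \<le> gp G * gm G - 1"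
    by (rule order_trans[OF degree_monom_le])
qed

text \<open>The largest exponent occurs at \<open>p'' = 1\<close>,
  \<open>n'' = gn G\<close>.\<close>

lemma degree_polB: "degree (polB B l k j c) \<le> rho - gp G * gm G + gp G - 1"
  unfolding polB_def
proof (rule degree_sum_le, simp, clarify)
  have aux: "1 \<le> i \<Longrightarrow> i \<le> P \<Longrightarrow> M + x \<le> y \<Longrightarrow> P - i + x \<le> y - M + P - 1" for i P M x y :: nat by simp
  fix p' n' assume *: "p' \<in> {1..gp G}" "n' \<in> {1..gn G}"
  have "gp G * gm G + gp G * gm G * (n' - 1) = gp G * gm G * n'" using * by (cases n') auto
  moreover have "gp G * gm G * n' \<le> rho" using * by (simp add: gR'_def)
  ultimately have "gp G - p' + gp G * gm G * (n' - 1) \<le> rho - gp G * gm G + gp G - 1"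
    using aux[of p' "gp G" "gp G * gm G" "gp G * gm G * (n' - 1)" rho] * by auto
  then show "degree (monom (blkB G (B (gKc G * (l - 1) + k)) p' n' $$ (j, c)) (gp G - p' + gp G * gm G * (n' - 1)))
      \<le> rho - gp G * gm G + gp G - 1"
    by (rule order_trans[OF degree_monom_le])
qed

lemma pm_le_rho: "gp G * gm G \<le> rho" "gp G \<le> gp G * gm G"
  using pos by (simp_all add: gR'_def)

text \<open>\<open>gDE\<close> is the larger of the degree bounds of \<open>polA\<close> and
  \<open>polB\<close>; it stays below \<open>rho\<close> because of
  \<open>pm_le_rho\<close>.\<close>

lemma DE_bounds:
  "gp G * gm G - 1 \<le> gDE G" "rho - gp G * gm G + gp G - 1 \<le> gDE G" "gDE G \<le> rho - 1"
proof -
  have "x - 1 \<le> max x (y - x + p) - 1 \<and> y - x + p - 1 \<le> max x (y - x + p) - 1 \<and> max x (y - x + p) - 1 \<le> y - 1"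
    if "x \<le> y" "p \<le> x" for x y p :: nat
    using that by auto
  from this[OF pm_le_rho]
  show "gp G * gm G - 1 \<le> gDE G" "rho - gp G * gm G + gp G - 1 \<le> gDE G" "gDE G \<le> rho - 1"
    unfolding gDE_def gR'_def[symmetric] by blast+
qed

text \<open>The two degree bounds add up to \<open>rho + gp G - 2\<close>, and
  \<open>gp G - 1\<close> is at most \<open>gDE G\<close>.\<close>

lemma degree_polA_polB:
  "degree (polA A l k r j) + degree (polB B l' k' j' c) + 1 \<le> rho + gDE G"
proof -
  have "a + b + 1 \<le> y + d" if "a \<le> x - 1" "b \<le> y - x + p - 1" "x \<le> y" "p \<le> x" "x - 1 \<le> d" "0 < p" for a b x y p d :: nat
    using that by linarith
  from this[OF degree_polA degree_polB pm_le_rho DE_bounds(1) pos(5)] show ?thesis .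
qed

text \<open>The second bound places the polynomial of \<open>Z'\<close> within the
  \<open>rho * gKc G + 2 * gX G - 1\<close> regular coefficients that \<open>gR\<close> provides
  for.\<close>

lemma NZ1_bounds: "0 < NZ1 G" "NZ1 G \<le> rho * gKc G + 2 * gX G - 1"
proof -
  have "rho * gKc G = rho * (gKc G - 1) + rho" using pos by (cases "gKc G") auto
  then show "0 < NZ1 G" "NZ1 G \<le> rho * gKc G + 2 * gX G - 1"
    using pos DE_bounds rho_pos by (auto simp: NZ1_def)
qed

lemma degree_prod_fac: "S \<subseteq> Ks \<Longrightarrow> degree (\<Prod>k\<in>S. fac l k) \<le> rho * card S"
  by (intro degree_prod_le_card degree_root_factor_power_le finite_subset[of S Ks]) auto

lemma degree_polZA: "degree (polZA z l r j) \<le> gX G - 1"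
  and degree_polZB: "degree (polZB z l r j) \<le> gX G - 1"
  unfolding polZA_def polZB_def by (rule degree_polZ)+

lemma degree_comp_lin [simp]: "degree (p \<circ>\<^sub>p lin l k) = degree p" for p :: "'a poly"
  by (simp add: degree_pcompose)

text \<open>Data times one source's noise has degree at most
  \<open>gDE G + rho * (gKc G - 1) + gX G - 1\<close>, exactly one less than the number of matrices
  \<open>Z'\<close>. Products of data from two poles have two factors \<open>fac\<close> fewer and
  also fit.\<close>

lemma degree_cross: "degree (cross A B z l r c j) < NZ1 G"
proof -
  have NZ1: "NZ1 G = rho * (gKc G - 1) + gX G + gDE G" by (simp add: NZ1_def)
  have t1: "degree ((polB B l k j c \<circ>\<^sub>p lin l k) *
      ((polA A l k' r j \<circ>\<^sub>p lin l k') * (\<Prod>i\<in>Ks - {k} - {k'}. fac l i))) \<le> NZ1 G - 1"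
    if k: "k \<in> Ks" "k' \<in> Ks - {k}" for k k'
  proof -
    have "card (Ks - {k} - {k'}) = gKc G - 2" using k by simp
    then have W: "degree (\<Prod>i\<in>Ks - {k} - {k'}. fac l i) \<le> rho * (gKc G - 2)"
      using degree_prod_fac[of "Ks - {k} - {k'}" l] by auto
    \<comment> \<open>Two distinct indices exist, so \<open>gKc G\<close> is at least 2 and the
      subtraction is not truncated.\<close>
    have "gKc G - 1 = Suc (gKc G - 2)" using k by auto
    then have "rho * (gKc G - 1) = rho * (gKc G - 2) + rho" by simp
    moreover have "degree ((polB B l k j c \<circ>\<^sub>p lin l k) *
      ((polA A l k' r j \<circ>\<^sub>p lin l k') * (\<Prod>i\<in>Ks - {k} - {k'}. fac l i)))
        \<le> degree (polB B l k j c) + (degree (polA A l k' r j) + rho * (gKc G - 2))"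
      using W by (intro order_trans[OF degree_mult_le] add_mono) simp_all
    ultimately show ?thesis using degree_polA_polB[of A l k' r j B l k j c] pos(2) by (simp add: NZ1)
  qed
  have V: "degree (\<Prod>i\<in>Ks - {k}. fac l i) \<le> rho * (gKc G - 1)" if "k \<in> Ks" for k
    using degree_prod_fac[of "Ks - {k}" l] that by auto
  have t2: "degree ((polB B l k j c \<circ>\<^sub>p lin l k) * ((\<Prod>i\<in>Ks - {k}. fac l i) * polZA z l r j)) \<le> NZ1 G - 1"
    if k: "k \<in> Ks" for k
  proof -
    have "degree ((polB B l k j c \<circ>\<^sub>p lin l k) * ((\<Prod>i\<in>Ks - {k}. fac l i) * polZA z l r j))
       \<le> degree (polB B l k j c) + (rho * (gKc G - 1) + (gX G - 1))"
      using V[OF k] degree_polZA by (intro order_trans[OF degree_mult_le] add_mono) simp_all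
    then show ?thesis using order_trans[OF degree_polB[of B l k j c] DE_bounds(2)] pos(2) unfolding NZ1 by linarith
  qed
  have t3: "degree ((polA A l k r j \<circ>\<^sub>p lin l k) * (\<Prod>i\<in>Ks - {k}. fac l i) * polZB z l j c) \<le> NZ1 G - 1"
    if k: "k \<in> Ks" for k
  proof -
    have "degree ((polA A l k r j \<circ>\<^sub>p lin l k) * (\<Prod>i\<in>Ks - {k}. fac l i) * polZB z l j c)
       \<le> degree (polA A l k r j) + rho * (gKc G - 1) + (gX G - 1)"
      using V[OF k] degree_polZB by (intro order_trans[OF degree_mult_le] add_mono) simp_all
    then show ?thesis using order_trans[OF degree_polA[of A l k r j] DE_bounds(1)] pos(2) unfolding NZ1 by linarith
  qed
  have "degree (cross A B z l r c j) \<le> NZ1 G - 1"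
    unfolding cross_def distrib_left sum_distrib_left sum_distrib_right
    by (intro degree_add_le degree_sum_le t1 t2 t3) auto
  then show ?thesis using NZ1_bounds by simp
qed

lemma degree_psi: "k \<in> Ks \<Longrightarrow> degree (psi l k) \<le> rho * (gKc G - 1)"
proof -
  assume k: "k \<in> Ks"
  have "degree ([:gf G l k' - gf G l k, 1:] ^ rho) \<le> rho" for k'
    by (rule order_trans[OF degree_power_le]) simp
  then have "degree (psi l k) \<le> rho * card (Ks - {k})"
    unfolding psi_def by (intro degree_prod_le_card) auto
  then show ?thesis using k by simp
qed

lemma degree_polAB: "degree (polAB A B l k r c) + 1 \<le> rho + gDE G"
proof -
  have "degree (polAB A B l k r c) \<le> rho + gDE G - 1"
    unfolding polAB_def
  proof (intro degree_sum_le order_trans[OF degree_mult_le])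
    fix j show "degree (polA A l k r j) + degree (polB B l k j c) \<le> rho + gDE G - 1"
      using degree_polA_polB[of A l k r j B l k j c] by simp
  qed simp
  then show ?thesis using rho_pos by simp
qed

text \<open>The shift lowers the degree of \<open>psi * polAB\<close> by \<open>rho\<close>, leaving
  less than \<open>rho * (gKc G - 1) + gDE G\<close>; the rest is
  \<open>degree_cross\<close>.\<close>

lemma degree_low_part: "degree (low_part A B z r c) < NZ1 G"
proof -
  have sh: "degree (poly_shift rho (psi l k * polAB A B l k r c)) < NZ1 G" if k: "k \<in> Ks" for l k
  proof (rule degree_less_if_coeff_0[OF _ NZ1_bounds(1)])
    fix i assume i: "NZ1 G \<le> i"
    have "degree (psi l k * polAB A B l k r c) \<le> rho * (gKc G - 1) + degree (polAB A B l k r c)"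
      using degree_psi[OF k] by (intro order_trans[OF degree_mult_le]) simp
    also have "\<dots> < i + rho" using i degree_polAB[of A B l k r c] by (simp add: NZ1_def)
    finally show "coeff (poly_shift rho (psi l k * polAB A B l k r c)) i = 0"
      by (simp add: coeff_poly_shift coeff_eq_0)
  qed
  have less: "d \<le> NZ1 G - 1 \<longleftrightarrow> d < NZ1 G" for d using NZ1_bounds(1) by linarith
  have "degree (low_part A B z r c) \<le> NZ1 G - 1"
    unfolding low_part_def
    by (intro degree_add_le degree_sum_le) (simp_all only: less degree_comp_lin sh degree_cross finite_atLeastAtMost finite_lessThan)
  then show ?thesis using NZ1_bounds by simp
qed

text \<open>All \<open>gKc G\<close> factors \<open>fac\<close> meet both source noises here. This
  term accounts for the summand \<open>rho * gKc G + 2 * gX G - 1\<close> of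
  \<open>gR\<close>.\<close>

lemma degree_top_part: "degree (top_part z r c) < rho * gKc G + 2 * gX G - 1"
proof -
  have "degree (top_part z r c) \<le> rho * gKc G + (gX G - 1) + (gX G - 1)"
    unfolding top_part_def using degree_prod_fac[of Ks] degree_polZA degree_polZB
    by (intro degree_sum_le order_trans[OF degree_mult_le] add_mono) auto
  then show ?thesis using pos(2) by simp
qed

lemma degree_pole: "degree (pole A B z l k r c) < rho"
  by (rule degree_less_if_coeff_0) (auto simp: pole_def coeff_poly_cutoff rho_pos)

text \<open>The poles within one batch are distinct, so no factor of \<open>psi\<close> vanishes at
  0.\<close>

lemma coeff_psi_0: "l \<in> Ls \<Longrightarrow> k \<in> Ks \<Longrightarrow> coeff (psi l k) 0 \<noteq> 0"
proof -
  assume lk: "l \<in> Ls" "k \<in> Ks"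
  have "gf G l k' \<noteq> gf G l k" if "k' \<in> Ks - {k}" for k'
    using inj_onD[OF dist_f, of "(l, k')" "(l, k)"] that lk by auto
  then show ?thesis by (auto simp: poly_0_coeff_0[symmetric] psi_def poly_prod)
qed

section \<open>Desired block products as coefficients of \<open>polAB\<close>\<close>

lemma dims: "glam G = gm G * rA G" "gkap G = gp G * cA G" "gmu G = gn G * cB G"
  using dvd by (simp_all add: rA_def cA_def cB_def)

lemma dims_pos: "0 < rA G" "0 < cA G" "0 < cB G"
  using dims pos by (auto intro!: Nat.gr0I)

text \<open>The exponents are mixed-radix expansions with digits in base \<open>gp G\<close> and
  then \<open>gm G\<close>, so equality forces equal digits. Terms with \<open>p'' = p'\<close> and
  no others land on the exponents belonging to \<open>gE\<close>.\<close>

lemma exponent_eq_iff: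
  assumes "p' \<in> {1..gp G}" "p'' \<in> {1..gp G}" "m' \<in> {1..gm G}" "m0 \<in> {1..gm G}" "n' \<ge> 1" "n0 \<ge> 1"
  shows "p' - 1 + gp G * (m' - 1) + (gp G - p'' + gp G * gm G * (n' - 1)) =
      gp G - 1 + gp G * (m0 - 1) + gp G * gm G * (n0 - 1) \<longleftrightarrow> m' = m0 \<and> n' = n0 \<and> p'' = p'"
    (is "?L \<longleftrightarrow> ?R")
proof
  assume ?L
  define a b where "a = (m' - 1) + gm G * (n' - 1)" and "b = (m0 - 1) + gm G * (n0 - 1)"
  \<comment> \<open>Moving \<open>p''\<close> to the other side removes the truncated subtraction
    and leaves two expansions in base \<open>gp G\<close>.\<close>
  have "i - 1 + x + (P - j + y) = P - 1 + x' + y' \<Longrightarrow> 1 \<le> i \<Longrightarrow> 1 \<le> j \<Longrightarrow> j \<le> P \<Longrightarrow> i - 1 + (x + y) = j - 1 + (x' + y')"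
    for i j P x y x' y' :: nat by linarith
  note this[OF \<open>?L\<close>]
  moreover have "gp G * a = gp G * (m' - 1) + gp G * gm G * (n' - 1)" "gp G * b = gp G * (m0 - 1) + gp G * gm G * (n0 - 1)"
    unfolding a_def b_def by (simp_all only: distrib_left mult.assoc)
  ultimately have eq: "(p' - 1) + gp G * a = (p'' - 1) + gp G * b"
    using assms by (simp only: atLeastAtMost_iff)
  have "p' - 1 < gp G" "p'' - 1 < gp G" using assms by auto
  note * = nat_div_mod_unique[OF eq this]
  have "m' - 1 < gm G" "m0 - 1 < gm G" using assms by auto
  note nat_div_mod_unique[OF *(2)[unfolded a_def b_def] this]
  then show ?R using * assms by auto
next
  assume ?R
  then show ?L using assms by auto
qed

text \<open>By \<open>exponent_eq_iff\<close> the coefficient collects the products of block row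
  \<open>m0\<close> with block column \<open>n0\<close> at matching inner blocks. The sums over the
  block index \<open>p'\<close> and the position \<open>j\<close> inside it make up the full inner
  product.\<close>

lemma coeff_polAB:
  assumes A: "A (gKc G * (l - 1) + k) \<in> carrier_mat (glam G) (gkap G)"
    and B: "B (gKc G * (l - 1) + k) \<in> carrier_mat (gkap G) (gmu G)"
    and m0: "m0 \<in> {1..gm G}" and n0: "n0 \<in> {1..gn G}" and rc: "r < rA G" "c < cB G"
  shows "coeff (polAB A B l k r c) (gp G - 1 + gp G * (m0 - 1) + gp G * gm G * (n0 - 1)) =
    (A (gKc G * (l - 1) + k) * B (gKc G * (l - 1) + k)) $$ ((m0 - 1) * rA G + r, (n0 - 1) * cB G + c)"
proof -
  let ?e = "gp G - 1 + gp G * (m0 - 1) + gp G * gm G * (n0 - 1)"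
  define t where "t = gKc G * (l - 1) + k"
  define R C where "R = (m0 - 1) * rA G + r" and "C = (n0 - 1) * cB G + c"
  have blk: "i * n + r < m * n" if "r < n" "i < m" for i n r m :: nat
  proof -
    have "i * n + r < Suc i * n" using that by simp
    also have "\<dots> \<le> m * n" using that by (intro mult_le_mono1) simp
    finally show ?thesis .
  qed
  have R: "R < glam G" unfolding R_def dims using m0 rc by (intro blk) auto
  have C: "C < gmu G" unfolding C_def dims using n0 rc by (intro blk) auto
  have j: "coeff (polA A l k r j * polB B l k j c) ?e =
      (\<Sum>p'\<in>{1..gp G}. A t $$ (R, (p' - 1) * cA G + j) * B t $$ ((p' - 1) * cA G + j, C))" if j: "j < cA G" for j
  proof -
    let ?a = "\<lambda>m' p'. blkA G (A t) m' p' $$ (r, j)" and ?b = "\<lambda>p'' n''. blkB G (B t) p'' n'' $$ (j, c)"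
    have "coeff (polA A l k r j * polB B l k j c) ?e =
      (\<Sum>(m', p')\<in>{1..gm G} \<times> {1..gp G}. \<Sum>(p'', n'')\<in>{1..gp G} \<times> {1..gn G}.
        if p' - 1 + gp G * (m' - 1) + (gp G - p'' + gp G * gm G * (n'' - 1)) = ?e then ?a m' p' * ?b p'' n'' else 0)"
      unfolding polA_def polB_def sum_product t_def[symmetric]
      by (simp only: coeff_sum split_def mult_monom coeff_monom)
    \<comment> \<open>The single exponent condition becomes nested index conditions, so that the
      sums can be collapsed one at a time.\<close>
    also have "\<dots> = (\<Sum>m'\<in>{1..gm G}. \<Sum>p'\<in>{1..gp G}. \<Sum>p''\<in>{1..gp G}. \<Sum>n''\<in>{1..gn G}.
        if m' = m0 then if p'' = p' then if n'' = n0 then ?a m' p' * ?b p'' n'' else 0 else 0 else 0)"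
      unfolding sum.cartesian_product[symmetric]
    proof (intro sum.cong refl)
      fix m' p' p'' n'' assume *: "m' \<in> {1..gm G}" "p' \<in> {1..gp G}" "p'' \<in> {1..gp G}" "n'' \<in> {1..gn G}"
      have "1 \<le> n''" "1 \<le> n0" using * n0 by simp_all
      note e = exponent_eq_iff[OF *(2,3,1) m0 this]
      show "(if p' - 1 + gp G * (m' - 1) + (gp G - p'' + gp G * gm G * (n'' - 1)) = ?e then ?a m' p' * ?b p'' n'' else 0)
          = (if m' = m0 then if p'' = p' then if n'' = n0 then ?a m' p' * ?b p'' n'' else 0 else 0 else 0)"
        unfolding e by auto
    qed
    also have "\<dots> = (\<Sum>m'\<in>{1..gm G}. \<Sum>p'\<in>{1..gp G}. \<Sum>p''\<in>{1..gp G}.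
        if m' = m0 then if p'' = p' then ?a m' p' * ?b p'' n0 else 0 else 0)"
    proof (intro sum.cong refl)
      fix m' p' p''
      show "(\<Sum>n''\<in>{1..gn G}. if m' = m0 then if p'' = p' then if n'' = n0 then ?a m' p' * ?b p'' n'' else 0 else 0 else 0)
          = (if m' = m0 then if p'' = p' then ?a m' p' * ?b p'' n0 else 0 else 0)"
        using n0 by (cases "m' = m0"; cases "p'' = p'") (simp_all add: sum.delta)
    qed
    also have "\<dots> = (\<Sum>m'\<in>{1..gm G}. \<Sum>p'\<in>{1..gp G}. if m' = m0 then ?a m' p' * ?b p' n0 else 0)"
    proof (intro sum.cong refl)
      fix m' p' assume "p' \<in> {1..gp G}"
      then show "(\<Sum>p''\<in>{1..gp G}. if m' = m0 then if p'' = p' then ?a m' p' * ?b p'' n0 else 0 else 0)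
          = (if m' = m0 then ?a m' p' * ?b p' n0 else 0)"
        by (cases "m' = m0") (simp_all add: sum.delta)
    qed
    also have "\<dots> = (\<Sum>p'\<in>{1..gp G}. ?a m0 p' * ?b p' n0)"
      using m0 by (subst sum.swap) (simp add: sum.delta)
    also have "\<dots> = (\<Sum>p'\<in>{1..gp G}. A t $$ (R, (p' - 1) * cA G + j) * B t $$ ((p' - 1) * cA G + j, C))"
      using rc j by (intro sum.cong refl) (simp add: blkA_def blkB_def R_def C_def)
    finally show ?thesis .
  qed
  have "coeff (polAB A B l k r c) ?e =
      (\<Sum>j<cA G. \<Sum>p'\<in>{1..gp G}. A t $$ (R, (p' - 1) * cA G + j) * B t $$ ((p' - 1) * cA G + j, C))"
    unfolding polAB_def coeff_sum by (rule sum.cong) (auto simp only: j lessThan_iff)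
  also have "\<dots> = (\<Sum>p'\<in>{1..gp G}. \<Sum>j<cA G. A t $$ (R, (p' - 1) * cA G + j) * B t $$ ((p' - 1) * cA G + j, C))"
    by (rule sum.swap)
  \<comment> \<open>Blocks are renumbered from 0, so that consecutive intervals of length
    \<open>cA G\<close> tile the inner dimension.\<close>
  also have "\<dots> = (\<Sum>p'<gp G. \<Sum>j<cA G. A t $$ (R, p' * cA G + j) * B t $$ (p' * cA G + j, C))"
    by (rule sum.reindex_bij_witness[of _ Suc "\<lambda>i. i - 1"]) auto
  also have "\<dots> = (\<Sum>p'<gp G. \<Sum>i\<in>{p' * cA G..<p' * cA G + cA G}. A t $$ (R, i) * B t $$ (i, C))"
  proof (rule sum.cong[OF refl])
    fix p' show "(\<Sum>j<cA G. A t $$ (R, p' * cA G + j) * B t $$ (p' * cA G + j, C))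
        = (\<Sum>i\<in>{p' * cA G..<p' * cA G + cA G}. A t $$ (R, i) * B t $$ (i, C))"
      by (rule sum.reindex_bij_witness[of _ "\<lambda>i. i - p' * cA G" "\<lambda>j. p' * cA G + j"]) auto
  qed
  also have "\<dots> = (\<Sum>i<gkap G. A t $$ (R, i) * B t $$ (i, C))"
    unfolding dims by (rule sum.nat_group)
  also have "\<dots> = (A t * B t) $$ (R, C)"
    using A B R C by (simp add: times_mat_def scalar_prod_def atLeast0LessThan t_def)
  finally show ?thesis by (simp only: t_def R_def C_def)
qed

subsection \<open>Recoverability\<close>

lemma batch_index_bound: "l \<in> Ls \<Longrightarrow> k \<in> Ks \<Longrightarrow> gKc G * (l - 1) + k \<in> {1..gL G}"
proof -
  assume l: "l \<in> Ls" and k: "k \<in> Ks"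
  have "gKc G * (l - 1) + gKc G = gKc G * l" using l by (cases l) auto
  moreover have "gKc G * l \<le> gKc G * gell G" using l by simp
  moreover have "gL G = gKc G * gell G" by (simp add: gL_def)
  moreover have "1 \<le> k" "k \<le> gKc G" using k by simp_all
  ultimately show ?thesis unfolding atLeastAtMost_iff by linarith
qed

lemma batch_index_exists:
  assumes "t \<in> {1..gL G}"
  obtains l k where "l \<in> Ls" "k \<in> Ks" "t = gKc G * (l - 1) + k"
proof
  have "t - 1 < gell G * gKc G" using assms by (auto simp: gL_def)
  then have "(t - 1) div gKc G < gell G" by (rule less_mult_imp_div_less)
  then show "(t - 1) div gKc G + 1 \<in> Ls" by simp
  show "(t - 1) mod gKc G + 1 \<in> Ks" using pos(4) by (simp add: Suc_le_eq)
  show "t = gKc G * ((t - 1) div gKc G + 1 - 1) + ((t - 1) mod gKc G + 1)"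
    using assms mult_div_mod_eq[of "gKc G" "t - 1"] by (simp del: mult_div_mod_eq)
qed

text \<open>\<open>gE\<close> numbers the masks from 1 and coefficients start at 0, hence the offset
  by one.\<close>

lemma Suc_in_gE_iff:
  "i + 1 \<in> gE G \<longleftrightarrow> (\<exists>m0\<in>{1..gm G}. \<exists>n0\<in>{1..gn G}. i = gp G - 1 + gp G * (m0 - 1) + gp G * gm G * (n0 - 1))"
proof -
  have "i + 1 = gp G + x + y \<longleftrightarrow> i = gp G - 1 + x + y" for x y using pos(5) by linarith
  then show ?thesis unfolding gE_def by blast
qed

lemma gE_bound: "i \<in> gE G \<Longrightarrow> i \<le> rho"
proof -
  assume "i \<in> gE G"
  then obtain m0 n0 where i: "i = gp G + gp G * (m0 - 1) + gp G * gm G * (n0 - 1)"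
    and m0: "m0 \<in> {1..gm G}" and n0: "n0 \<in> {1..gn G}" unfolding gE_def by blast
  have "gp G + gp G * (m0 - 1) = gp G * m0" using m0 by (cases m0) auto
  moreover have "gp G * m0 \<le> gp G * gm G" using m0 by simp
  moreover have "gp G * gm G + gp G * gm G * (n0 - 1) = gp G * gm G * n0" using n0 by (cases n0) auto
  moreover have "gp G * gm G * n0 \<le> rho" using n0 by (simp add: gR'_def)
  ultimately show ?thesis using i by linarith
qed

lemma A_carrier: "A \<in> Aspace G \<Longrightarrow> t \<in> {1..gL G} \<Longrightarrow> A t \<in> carrier_mat (glam G) (gkap G)"
  and B_carrier: "B \<in> Bspace G \<Longrightarrow> t \<in> {1..gL G} \<Longrightarrow> B t \<in> carrier_mat (gkap G) (gmu G)"
  by (auto simp: Aspace_def Bspace_def)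

text \<open>The direction used for privacy: at the unmasked exponents \<open>polAB\<close> reveals
  the products only.\<close>

lemma coeff_polAB_eq_if_products_eq:
  assumes sp: "A \<in> Aspace G" "B \<in> Bspace G" "A' \<in> Aspace G" "B' \<in> Bspace G"
    and eq: "(\<lambda>t\<in>{1..gL G}. A t * B t) = (\<lambda>t\<in>{1..gL G}. A' t * B' t)"
    and lk: "l \<in> Ls" "k \<in> Ks" and rc: "r < rA G" "c < cB G" and i: "i + 1 \<in> gE G"
  shows "coeff (polAB A B l k r c) i = coeff (polAB A' B' l k r c) i"
proof -
  obtain m0 n0 where m0: "m0 \<in> {1..gm G}" and n0: "n0 \<in> {1..gn G}"
    and i: "i = gp G - 1 + gp G * (m0 - 1) + gp G * gm G * (n0 - 1)"
    using i unfolding Suc_in_gE_iff by blast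
  note t = batch_index_bound[OF lk]
  have "A (gKc G * (l - 1) + k) * B (gKc G * (l - 1) + k) = A' (gKc G * (l - 1) + k) * B' (gKc G * (l - 1) + k)"
    using fun_cong[OF eq, of "gKc G * (l - 1) + k"] t by (simp only: restrict_apply if_True)
  then show ?thesis
    unfolding i
    by (simp only: coeff_polAB[where A = A and B = B and l = l and k = k, OF A_carrier[OF sp(1) t] B_carrier[OF sp(2) t] m0 n0 rc]
        coeff_polAB[where A = A' and B = B' and l = l and k = k, OF A_carrier[OF sp(3) t] B_carrier[OF sp(4) t] m0 n0 rc])
qed

text \<open>The direction used for decoding: every entry of a product lies in some block, and
  \<open>gE\<close> meets every block.\<close>

lemma products_eq_if_coeff_polAB_eq:
  assumes sp: "A \<in> Aspace G" "B \<in> Bspace G" "A' \<in> Aspace G" "B' \<in> Bspace G"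
    and eq: "\<And>l k r c i. l \<in> Ls \<Longrightarrow> k \<in> Ks \<Longrightarrow> r < rA G \<Longrightarrow> c < cB G \<Longrightarrow> i + 1 \<in> gE G \<Longrightarrow>
      coeff (polAB A B l k r c) i = coeff (polAB A' B' l k r c) i"
  shows "(\<lambda>t\<in>{1..gL G}. A t * B t) = (\<lambda>t\<in>{1..gL G}. A' t * B' t)"
proof (rule restrict_ext)
  fix t assume t: "t \<in> {1..gL G}"
  then obtain l k where lk: "l \<in> Ls" "k \<in> Ks" and t_eq: "t = gKc G * (l - 1) + k"
    by (rule batch_index_exists)
  note t' = batch_index_bound[OF lk]
  note carr = A_carrier[OF sp(1) t] B_carrier[OF sp(2) t] A_carrier[OF sp(3) t] B_carrier[OF sp(4) t]
  show "A t * B t = A' t * B' t"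
  proof (rule eq_matI)
    fix R C assume "R < dim_row (A' t * B' t)" "C < dim_col (A' t * B' t)"
    then have R: "R < gm G * rA G" and C: "C < gn G * cB G" using carr dims by auto
    define m0 n0 r c where "m0 = R div rA G + 1" and "n0 = C div cB G + 1"
      and "r = R mod rA G" and "c = C mod cB G"
    have m0: "m0 \<in> {1..gm G}" using less_mult_imp_div_less[OF R] by (simp add: m0_def)
    have n0: "n0 \<in> {1..gn G}" using less_mult_imp_div_less[OF C] by (simp add: n0_def)
    have rc: "r < rA G" "c < cB G" using dims_pos by (simp_all add: r_def c_def)
    have RC: "R = (m0 - 1) * rA G + r" "C = (n0 - 1) * cB G + c"
      by (simp_all add: m0_def n0_def r_def c_def)
    have "gp G - 1 + gp G * (m0 - 1) + gp G * gm G * (n0 - 1) + 1 \<in> gE G"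
      unfolding Suc_in_gE_iff using m0 n0 by blast
    from eq[OF lk rc this] show "(A t * B t) $$ (R, C) = (A' t * B' t) $$ (R, C)"
      unfolding t_eq RC
      by (simp only: coeff_polAB[where A = A and B = B and l = l and k = k, OF A_carrier[OF sp(1) t'] B_carrier[OF sp(2) t'] m0 n0 rc]
        coeff_polAB[where A = A' and B = B' and l = l and k = k, OF A_carrier[OF sp(3) t'] B_carrier[OF sp(4) t'] m0 n0 rc])
  qed (use carr in auto)
qed

lemma coeff_polZ2_gE: "i + 1 \<in> gE G \<Longrightarrow> r < rA G \<Longrightarrow> c < cB G \<Longrightarrow> coeff (polZ2 z l k r c) i = 0"
  by (simp add: polZ2_def coeff_polZ Z2_def)

text \<open>The difference of the two answer functions vanishes at the points of all servers in
  \<open>Rs\<close>, so \<open>partial_fractions_eq_0\<close> makes the polar parts agree although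
  the noises may differ.\<close>

lemma products_determined:
  assumes sp: "A \<in> Aspace G" "B \<in> Bspace G" "A' \<in> Aspace G" "B' \<in> Bspace G"
    and z: "z \<in> NoiseSpace G" "z' \<in> NoiseSpace G"
    and Rs: "Rs \<subseteq> {1..gS G}" "card Rs = gR G"
    and Y: "\<And>s. s \<in> Rs \<Longrightarrow> Yans G (A, B, z) s = Yans G (A', B', z') s"
  shows "(\<lambda>t\<in>{1..gL G}. A t * B t) = (\<lambda>t\<in>{1..gL G}. A' t * B' t)"
proof (rule products_eq_if_coeff_polAB_eq[OF sp])
  fix l k r c i assume lk: "l \<in> Ls" "k \<in> Ks" and rc: "r < rA G" "c < cB G" and i: "i + 1 \<in> gE G"
  let ?N = "rho * gKc G + 2 * gX G - 1"
  define T where "T = (\<lambda>(l, k). pole A B z l k r c - pole A' B' z' l k r c)"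
  define b where "b = (low_part A B z r c + top_part z r c + polZ (NZ1 G) (nZ1 z) r c)
    - (low_part A' B' z' r c + top_part z' r c + polZ (NZ1 G) (nZ1 z') r c)"
  define e where "e = (\<lambda>(l, k). gf G l k)"
  have inj: "inj_on (galpha G) Rs" using dist_alpha Rs(1) by (rule inj_on_subset)
  have "T (l, k) = 0"
  proof (rule partial_fractions_eq_0[of "Ls \<times> Ks" e T rho b ?N "galpha G ` Rs"])
    show "inj_on e (Ls \<times> Ks)" using dist_f by (simp add: e_def)
    show "degree (T i) < rho" for i
      by (cases i) (simp add: T_def degree_diff_less degree_pole)
    have N: "degree (low_part A B z r c) < ?N" "degree (polZ (NZ1 G) Z r c) < ?N" for A B z and Z :: "nat \<Rightarrow> 'a mat"
      using degree_low_part[of A B z r c] degree_polZ[of "NZ1 G" Z r c] NZ1_bounds by linarith+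
    show "degree b < ?N"
      unfolding b_def by (intro degree_diff_less degree_add_less N degree_top_part)
    \<comment> \<open>The polar coefficients and the bound on the regular ones add up to exactly the
      recovery threshold.\<close>
    have "rho * card (Ls \<times> Ks) + ?N = gR G"
      using pos(2) by (simp add: gR_def gR'_def card_cartesian_product algebra_simps)
    then show "rho * card (Ls \<times> Ks) + ?N \<le> card (galpha G ` Rs)"
      using Rs(2) card_image[OF inj] by simp
    show "finite (galpha G ` Rs)" using finite_subset[OF Rs(1)] by simp
    show "e i \<noteq> a" if "a \<in> galpha G ` Rs" "i \<in> Ls \<times> Ks" for a i
      using that dist_af Rs(1) by (force simp: e_def)
    fix a assume "a \<in> galpha G ` Rs"
    then obtain s where s: "s \<in> Rs" and a: "a = galpha G s" by blast
    have s': "s \<in> {1..gS G}" using s Rs by blast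
    have Y_eq: "(\<Sum>(l, k)\<in>Ls \<times> Ks. poly (pole A B z l k r c) (gf G l k - a) / (gf G l k - a) ^ rho)
        + poly (low_part A B z r c + top_part z r c + polZ (NZ1 G) (nZ1 z) r c) a =
      (\<Sum>(l, k)\<in>Ls \<times> Ks. poly (pole A' B' z' l k r c) (gf G l k - a) / (gf G l k - a) ^ rho)
        + poly (low_part A' B' z' r c + top_part z' r c + polZ (NZ1 G) (nZ1 z') r c) a"
      using arg_cong[OF Y[OF s], of "\<lambda>M. M $$ (r, c)"]
      unfolding Yans_index[OF z(1) rc s'] Yans_index[OF z(2) rc s'] a .
    have T_eq: "(\<Sum>i\<in>Ls \<times> Ks. poly (T i) (e i - a) / (e i - a) ^ rho) =
      (\<Sum>(l, k)\<in>Ls \<times> Ks. poly (pole A B z l k r c) (gf G l k - a) / (gf G l k - a) ^ rho) -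
      (\<Sum>(l, k)\<in>Ls \<times> Ks. poly (pole A' B' z' l k r c) (gf G l k - a) / (gf G l k - a) ^ rho)"
      unfolding sum_subtractf[symmetric] by (rule sum.cong) (auto simp: T_def e_def diff_divide_distrib)
    have "x - y + (p - q) = 0" if "x + p = y + q" for x y p q :: 'a
      using that by (simp add: algebra_simps)
    from this[OF Y_eq] show "(\<Sum>i\<in>Ls \<times> Ks. poly (T i) (e i - a) / (e i - a) ^ rho) + poly b a = 0"
      unfolding T_eq b_def poly_diff .
  qed (use lk in auto)
  then have "pole A B z l k r c = pole A' B' z' l k r c" by (simp add: T_def)
  moreover have "i < rho" using gE_bound[OF i] by simp
  \<comment> \<open>\<open>psi\<close> is cancelled modulo the power \<open>rho\<close>; at an index
    of \<open>gE\<close> the mask contributes nothing.\<close>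
  ultimately have "coeff (polAB A B l k r c + polZ2 z l k r c) i = coeff (polAB A' B' l k r c + polZ2 z' l k r c) i"
    unfolding pole_def using coeff_psi_0[OF lk] by (intro poly_cutoff_mult_cancel)
  then show "coeff (polAB A B l k r c) i = coeff (polAB A' B' l k r c) i"
    by (simp add: coeff_polZ2_gE[OF i rc])
qed

section \<open>The noise space as a product of source and server noise\<close>

abbreviation "Z3_index \<equiv> {(l, k, i). l \<in> Ls \<and> k \<in> Ks \<and> i \<in> {1..rho} - gE G}"

lemma NoiseSpace_PiE:
  assumes "z \<in> NoiseSpace G"
  shows "nZA z \<in> PiE (Ls \<times> {1..gX G}) (\<lambda>_. carrier_mat (rA G) (cA G))"
    and "nZB z \<in> PiE (Ls \<times> {1..gX G}) (\<lambda>_. carrier_mat (cA G) (cB G))"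
    and "nZ1 z \<in> PiE {1..NZ1 G} (\<lambda>_. carrier_mat (rA G) (cB G))"
    and "nZ3 z \<in> PiE Z3_index (\<lambda>_. carrier_mat (rA G) (cB G))"
  using assms unfolding NoiseSpace_def by simp_all

lemma low_part_cong: "nZA z = nZA z' \<Longrightarrow> nZB z = nZB z' \<Longrightarrow> low_part A B z r c = low_part A B z' r c"
  by (simp add: low_part_def cross_def polZA_def polZB_def)

lemma top_part_cong: "nZA z = nZA z' \<Longrightarrow> nZB z = nZB z' \<Longrightarrow> top_part z r c = top_part z' r c"
  by (simp add: top_part_def polZA_def polZB_def)

lemma Mt_cong: "nZ1 z = nZ1 z' \<Longrightarrow> nZ3 z = nZ3 z' \<Longrightarrow> Mt G (A, B, z) s = Mt G (A', B', z') s"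
  unfolding Mt_def Z2_def oN_def by (simp only: snd_conv)

lemma Mset_cong:
  assumes "nZ1 z = nZ1 z'" "nZ3 z = nZ3 z'"
  shows "Mset G (A, B, z) Xs = Mset G (A', B', z') Xs"
  unfolding Mset_def Mrecv_def msg_def Mt_cong[OF assms, of A B _ A' B'] ..

text \<open>Shares read only this component and messages only \<open>server_noise\<close>; strong
  security follows from this separation.\<close>

definition source_noise :: "((nat \<times> nat \<Rightarrow> 'a mat) \<times> (nat \<times> nat \<Rightarrow> 'a mat)) set" where
  "source_noise = PiE (Ls \<times> {1..gX G}) (\<lambda>_. carrier_mat (rA G) (cA G))
     \<times> PiE (Ls \<times> {1..gX G}) (\<lambda>_. carrier_mat (cA G) (cB G))"

definition server_noise :: "((nat \<Rightarrow> 'a mat) \<times> (nat \<times> nat \<times> nat \<Rightarrow> 'a mat)) set" where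
  "server_noise = PiE {1..NZ1 G} (\<lambda>_. carrier_mat (rA G) (cB G))
     \<times> PiE Z3_index (\<lambda>_. carrier_mat (rA G) (cB G))"

definition noise_of :: "((nat \<times> nat \<Rightarrow> 'a mat) \<times> (nat \<times> nat \<Rightarrow> 'a mat)) \<times>
    ((nat \<Rightarrow> 'a mat) \<times> (nat \<times> nat \<times> nat \<Rightarrow> 'a mat)) \<Rightarrow> 'a noise" where
  "noise_of = (\<lambda>(u, v). \<lparr>nZA = fst u, nZB = snd u, nZ1 = fst v, nZ3 = snd v\<rparr>)"

lemma finite_source_noise: "finite source_noise"
  unfolding source_noise_def by (intro finite_cartesian_product finite_PiE finite_carrier_mat) simp_all

lemma finite_server_noise: "finite server_noise"
proof -
  have "finite Z3_index"
    by (rule finite_subset[of _ "Ls \<times> Ks \<times> {1..rho}"]) blast+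
  then show ?thesis
    unfolding server_noise_def by (intro finite_cartesian_product finite_PiE finite_carrier_mat) simp_all
qed

lemma noise_nonempty: "source_noise \<noteq> {}" "server_noise \<noteq> {}"
proof -
  have carr: "carrier_mat r c \<noteq> ({} :: 'a mat set)" for r c
    using zero_carrier_mat[of r c] by blast
  show "source_noise \<noteq> {}" "server_noise \<noteq> {}"
    unfolding source_noise_def server_noise_def Times_empty PiE_eq_empty_iff by (simp_all add: carr)
qed

lemma NoiseSpace_eq: "NoiseSpace G = noise_of ` (source_noise \<times> server_noise)"
proof (intro equalityI subsetI)
  fix z :: "'a noise" assume "z \<in> NoiseSpace G"
  then have "((nZA z, nZB z), (nZ1 z, nZ3 z)) \<in> source_noise \<times> server_noise"
    unfolding NoiseSpace_def source_noise_def server_noise_def by (simp only: mem_Sigma_iff mem_Collect_eq simp_thms)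
  moreover have "z = noise_of ((nZA z, nZB z), (nZ1 z, nZ3 z))" by (simp add: noise_of_def)
  ultimately show "z \<in> noise_of ` (source_noise \<times> server_noise)" by (rule rev_image_eqI)
next
  fix z :: "'a noise" assume "z \<in> noise_of ` (source_noise \<times> server_noise)"
  then obtain a b c d where z: "z = noise_of ((a, b), (c, d))" and "(a, b) \<in> source_noise" "(c, d) \<in> server_noise"
    by (elim imageE SigmaE) (metis surj_pair)
  then show "z \<in> NoiseSpace G"
    unfolding NoiseSpace_def source_noise_def server_noise_def z noise_of_def
    by (simp only: mem_Sigma_iff mem_Collect_eq simp_thms split_conv fst_conv snd_conv noise.simps)
qed

lemma finite_NoiseSpace: "finite (NoiseSpace G)"
  and NoiseSpace_nonempty: "NoiseSpace G \<noteq> {}"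
  unfolding NoiseSpace_eq using finite_source_noise finite_server_noise noise_nonempty by simp_all

lemma inj_noise_of: "inj noise_of"
  by (rule injI) (auto simp: noise_of_def prod_eq_iff)

text \<open>The uniform law on a product set is a product law, so source and server noise are
  independent.\<close>

lemma pmf_of_NoiseSpace:
  "pmf_of_set (NoiseSpace G) = map_pmf noise_of (pair_pmf (pmf_of_set source_noise) (pmf_of_set server_noise))"
proof -
  have "map_pmf noise_of (pmf_of_set (source_noise \<times> server_noise)) = pmf_of_set (NoiseSpace G)"
    unfolding NoiseSpace_eq
    by (rule map_pmf_of_set_inj[OF inj_on_subset[OF inj_noise_of subset_UNIV]])
       (use finite_source_noise finite_server_noise noise_nonempty in simp_all)
  then show ?thesis
    using pmf_of_set_Times[OF finite_source_noise noise_nonempty(1) finite_server_noise noise_nonempty(2)] by simp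
qed

subsection \<open>Noise translations\<close>

text \<open>The translation \<open>T\<close> moves the change of \<open>polAB\<close> outside
  \<open>gE\<close> into \<open>Z'''\<close> and the change of \<open>low_part\<close> into
  \<open>Z'\<close>. On \<open>gE\<close> there is no change, since the products agree, and
  \<open>top_part\<close> does not involve the inputs.\<close>

lemma answers_distribution:
  assumes sp: "A \<in> Aspace G" "B \<in> Bspace G" "A' \<in> Aspace G" "B' \<in> Bspace G"
    and eq: "(\<lambda>t\<in>{1..gL G}. A t * B t) = (\<lambda>t\<in>{1..gL G}. A' t * B' t)"
  shows "map_pmf (\<lambda>z. \<lambda>s\<in>{1..gS G}. Yans G (A, B, z) s) (pmf_of_set (NoiseSpace G)) =
    map_pmf (\<lambda>z. \<lambda>s\<in>{1..gS G}. Yans G (A', B', z) s) (pmf_of_set (NoiseSpace G))"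
proof -
  define d1 where "d1 z x r c = coeff (low_part A B z r c - low_part A' B' z r c) (x - 1)" for z x r c
  define d3 where "d3 = (\<lambda>(l, k, i) r c. coeff (polAB A B l k r c - polAB A' B' l k r c) (i - 1))"
  define T where "T z = z\<lparr>nZ1 := shift_mats {1..NZ1 G} (rA G) (cB G) (nZ1 z) (d1 z),
    nZ3 := shift_mats Z3_index (rA G) (cB G) (nZ3 z) d3\<rparr>" for z
  have T_sel [simp]: "nZA (T z) = nZA z" "nZB (T z) = nZB z"
    "nZ1 (T z) = shift_mats {1..NZ1 G} (rA G) (cB G) (nZ1 z) (d1 z)"
    "nZ3 (T z) = shift_mats Z3_index (rA G) (cB G) (nZ3 z) d3" for z
    by (simp_all add: T_def)
  have T_space: "T z \<in> NoiseSpace G" if "z \<in> NoiseSpace G" for z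
    using that unfolding NoiseSpace_def mem_Collect_eq T_sel by (simp only: shift_mats_PiE simp_thms)
  show ?thesis
  proof (rule map_pmf_of_set_eq_if_inj[OF finite_NoiseSpace NoiseSpace_nonempty])
    show "T ` NoiseSpace G \<subseteq> NoiseSpace G" using T_space by blast
    show "inj_on T (NoiseSpace G)"
    proof (rule inj_onI)
      fix z z' assume z: "z \<in> NoiseSpace G" "z' \<in> NoiseSpace G" and eq: "T z = T z'"
      have AB: "nZA z = nZA z'" "nZB z = nZB z'"
        using arg_cong[OF eq, of nZA] arg_cong[OF eq, of nZB] by simp_all
      \<comment> \<open>The shift of \<open>Z'\<close> depends on \<open>z\<close>, but only through
        the source noise, which \<open>T\<close> leaves fixed; so \<open>T\<close> is still
        injective.\<close>
      have "d1 z = d1 z'" unfolding d1_def by (simp only: low_part_cong[OF AB])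
      with arg_cong[OF eq, of nZ1] have "nZ1 z = nZ1 z'"
        unfolding T_sel by (intro shift_mats_inj[OF NoiseSpace_PiE(3)[OF z(1)] NoiseSpace_PiE(3)[OF z(2)]]) simp
      moreover have "nZ3 z = nZ3 z'"
        using arg_cong[OF eq, of nZ3] unfolding T_sel
        by (rule shift_mats_inj[OF NoiseSpace_PiE(4)[OF z(1)] NoiseSpace_PiE(4)[OF z(2)]])
      ultimately show "z = z'" using AB by simp
    qed
    fix z assume z: "z \<in> NoiseSpace G"
    note Tz = T_space[OF z]
    show "(\<lambda>s\<in>{1..gS G}. Yans G (A, B, z) s) = (\<lambda>s\<in>{1..gS G}. Yans G (A', B', T z) s)"
    proof (intro restrict_ext eq_matI)
      fix s r c assume s: "s \<in> {1..gS G}" and "r < dim_row (Yans G (A', B', T z) s)" "c < dim_col (Yans G (A', B', T z) s)"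
      then have rc: "r < rA G" "c < cB G" by simp_all
      have pole: "pole A B z l k r c = pole A' B' (T z) l k r c" if lk: "l \<in> Ls" "k \<in> Ks" for l k
        unfolding pole_def
      proof (rule poly_cutoff_mult_cong, rule poly_eqI)
        fix i
        have "coeff (polAB A B l k r c + polZ2 z l k r c) i = coeff (polAB A' B' l k r c + polZ2 (T z) l k r c) i"
          if i: "i < rho"
        proof (cases "i + 1 \<in> gE G")
          case True
          then show ?thesis
            using coeff_polAB_eq_if_products_eq[OF sp eq lk rc True] by (simp add: coeff_polZ2_gE[OF True rc])
        next
          case False
          then have "(l, k, i + 1) \<in> Z3_index" using lk i by simp
          from shift_mats_index[OF this rc, of "nZ3 z" d3]
          show ?thesis using False i by (simp add: polZ2_def coeff_polZ Z2_def oN_def d3_def)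
        qed
        then show "coeff (poly_cutoff rho (polAB A B l k r c + polZ2 z l k r c)) i =
            coeff (poly_cutoff rho (polAB A' B' l k r c + polZ2 (T z) l k r c)) i"
          by (simp add: coeff_poly_cutoff)
      qed
      have low: "low_part A' B' (T z) r c = low_part A' B' z r c" by (rule low_part_cong) simp_all
      have "low_part A B z r c + polZ (NZ1 G) (nZ1 z) r c = low_part A' B' (T z) r c + polZ (NZ1 G) (nZ1 (T z)) r c"
        unfolding low
      proof (rule poly_eqI)
        fix i
        show "coeff (low_part A B z r c + polZ (NZ1 G) (nZ1 z) r c) i = coeff (low_part A' B' z r c + polZ (NZ1 G) (nZ1 (T z)) r c) i"
        proof (cases "i < NZ1 G")
          case True
          then have "i + 1 \<in> {1..NZ1 G}" by simp
          from shift_mats_index[OF this rc, of "nZ1 z" "d1 z"]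
          show ?thesis using True by (simp add: coeff_polZ d1_def)
        next
          \<comment> \<open>No matrix \<open>Z'\<close> reaches these coefficients, but both low
            parts vanish there by their degree.\<close>
          case False
          then show ?thesis
            using degree_low_part[of A B z r c] degree_low_part[of A' B' z r c] by (simp add: coeff_polZ coeff_eq_0)
        qed
      qed
      moreover have "top_part (T z) r c = top_part z r c" by (rule top_part_cong) simp_all
      ultimately have b: "low_part A B z r c + top_part z r c + polZ (NZ1 G) (nZ1 z) r c =
          low_part A' B' (T z) r c + top_part (T z) r c + polZ (NZ1 G) (nZ1 (T z)) r c"
        by (simp only: add_ac)
      show "Yans G (A, B, z) s $$ (r, c) = Yans G (A', B', T z) s $$ (r, c)"
        unfolding Yans_index[OF z rc s] Yans_index[OF Tz rc s] b
        by (intro arg_cong2[where f = "(+)"] refl sum.cong) (auto simp: pole)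
    qed simp_all
  qed
qed

text \<open>Distinct servers have distinct points, so values indexed by servers can be interpolated;
  \<open>inv_into\<close> passes from points back to servers.\<close>

lemma interpolation_on_servers:
  assumes "Xs \<subseteq> {1..gS G}" "card Xs \<le> gX G"
  shows "\<exists>q. (\<forall>i\<ge>gX G. coeff q i = 0) \<and> (\<forall>s\<in>Xs. poly q (galpha G s) = g s)"
proof -
  have inj: "inj_on (galpha G) Xs" using dist_alpha assms(1) by (rule inj_on_subset)
  have fin: "finite Xs" using finite_subset[OF assms(1)] by simp
  obtain q where q: "\<forall>i\<ge>card (galpha G ` Xs). coeff q i = 0"
    "\<forall>a\<in>galpha G ` Xs. poly q a = g (inv_into Xs (galpha G) a)"
    using lagrange_interpolation_exists[of "galpha G ` Xs" "\<lambda>a. g (inv_into Xs (galpha G) a)"] fin by auto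
  show ?thesis
    using q assms(2) inj by (intro exI[of _ q]) (auto simp: card_image)
qed

text \<open>For at most \<open>gX G\<close> servers the change of the data part of each share entry
  is interpolated by a polynomial with \<open>gX G\<close> coefficients, and the source noise is
  translated by these. Messages are untouched. The inputs are arbitrary functions.\<close>

lemma view_distribution:
  assumes Xs: "Xs \<subseteq> {1..gS G}" "card Xs \<le> gX G"
  shows "map_pmf (\<lambda>z. ((\<lambda>s\<in>Xs. shareA G (A, B, z) s), (\<lambda>s\<in>Xs. shareB G (A, B, z) s), Mset G (A, B, z) Xs))
      (pmf_of_set (NoiseSpace G)) =
    map_pmf (\<lambda>z. ((\<lambda>s\<in>Xs. shareA G (A', B', z) s), (\<lambda>s\<in>Xs. shareB G (A', B', z) s), Mset G (A', B', z) Xs))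
      (pmf_of_set (NoiseSpace G))"
proof -
  define sA where "sA A l r j s = (\<Sum>k\<in>Ks. poly (polA A l k r j) (gf G l k - galpha G s) / (gf G l k - galpha G s) ^ rho)"
    for A l r j s
  define sB where "sB B l r j s = (\<Sum>k\<in>Ks. poly (polB B l k r j) (gf G l k - galpha G s) / (gf G l k - galpha G s) ^ rho)"
    for B l r j s
  \<comment> \<open>One interpolating polynomial is chosen for every batch and matrix position at
    once; its coefficients are the entries of the translation.\<close>
  have "\<exists>qA. \<forall>l r j. (\<forall>i\<ge>gX G. coeff (qA l r j) i = 0) \<and> (\<forall>s\<in>Xs. poly (qA l r j) (galpha G s) = sA A l r j s - sA A' l r j s)"
    using interpolation_on_servers[OF Xs] by (intro choice allI)
  then obtain qA where qA: "\<And>l r j i. i \<ge> gX G \<Longrightarrow> coeff (qA l r j) i = 0"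
    "\<And>l r j s. s \<in> Xs \<Longrightarrow> poly (qA l r j) (galpha G s) = sA A l r j s - sA A' l r j s" by blast
  have "\<exists>qB. \<forall>l r j. (\<forall>i\<ge>gX G. coeff (qB l r j) i = 0) \<and> (\<forall>s\<in>Xs. poly (qB l r j) (galpha G s) = sB B l r j s - sB B' l r j s)"
    using interpolation_on_servers[OF Xs] by (intro choice allI)
  then obtain qB where qB: "\<And>l r j i. i \<ge> gX G \<Longrightarrow> coeff (qB l r j) i = 0"
    "\<And>l r j s. s \<in> Xs \<Longrightarrow> poly (qB l r j) (galpha G s) = sB B l r j s - sB B' l r j s" by blast
  define dA where "dA = (\<lambda>(l, x) r j. coeff (qA l r j) (x - 1))"
  define dB where "dB = (\<lambda>(l, x) r j. coeff (qB l r j) (x - 1))"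
  define I where "I = Ls \<times> {1..gX G}"
  define T where "T z = z\<lparr>nZA := shift_mats I (rA G) (cA G) (nZA z) dA,
    nZB := shift_mats I (cA G) (cB G) (nZB z) dB\<rparr>" for z :: "'a noise"
  have T_sel [simp]: "nZA (T z) = shift_mats I (rA G) (cA G) (nZA z) dA"
    "nZB (T z) = shift_mats I (cA G) (cB G) (nZB z) dB" "nZ1 (T z) = nZ1 z" "nZ3 (T z) = nZ3 z" for z
    by (simp_all add: T_def)
  have T_space: "T z \<in> NoiseSpace G" if "z \<in> NoiseSpace G" for z
    using that unfolding NoiseSpace_def mem_Collect_eq T_sel I_def by (simp only: shift_mats_PiE simp_thms)
  have polZ_shift: "polZ (gX G) (\<lambda>x. shift_mats I n m Z d (l, x)) r j = polZ (gX G) (\<lambda>x. Z (l, x)) r j + q l r j"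
    if "l \<in> Ls" "r < n" "j < m" "\<And>i. i \<ge> gX G \<Longrightarrow> coeff (q l r j) i = 0"
      "d = (\<lambda>(l, x) r j. coeff (q l r j) (x - 1))" for l n m r j and Z :: "nat \<times> nat \<Rightarrow> 'a mat" and d q
  proof (rule poly_eqI)
    fix i
    show "coeff (polZ (gX G) (\<lambda>x. shift_mats I n m Z d (l, x)) r j) i = coeff (polZ (gX G) (\<lambda>x. Z (l, x)) r j + q l r j) i"
    proof (cases "i < gX G")
      case True
      then have "(l, i + 1) \<in> I" using that by (simp add: I_def)
      from shift_mats_index[OF this that(2,3), of Z d] show ?thesis
        using True that(5) by (simp add: coeff_polZ)
    qed (use that(4) in \<open>simp add: coeff_polZ\<close>)
  qed
  show ?thesis
  proof (rule map_pmf_of_set_eq_if_inj[OF finite_NoiseSpace NoiseSpace_nonempty])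
    show "T ` NoiseSpace G \<subseteq> NoiseSpace G" using T_space by blast
    show "inj_on T (NoiseSpace G)"
    proof (rule inj_onI)
      fix z z' assume z: "z \<in> NoiseSpace G" "z' \<in> NoiseSpace G" and eq: "T z = T z'"
      have "nZ1 z = nZ1 z'" "nZ3 z = nZ3 z'"
        using arg_cong[OF eq, of nZ1] arg_cong[OF eq, of nZ3] by simp_all
      moreover have "nZA z = nZA z'"
        using arg_cong[OF eq, of nZA] unfolding T_sel I_def
        by (rule shift_mats_inj[OF NoiseSpace_PiE(1)[OF z(1)] NoiseSpace_PiE(1)[OF z(2)]])
      moreover have "nZB z = nZB z'"
        using arg_cong[OF eq, of nZB] unfolding T_sel I_def
        by (rule shift_mats_inj[OF NoiseSpace_PiE(2)[OF z(1)] NoiseSpace_PiE(2)[OF z(2)]])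
      ultimately show "z = z'" by simp
    qed
    fix z assume z: "z \<in> NoiseSpace G"
    note Tz = T_space[OF z]
    have "At G (A, B, z) s l = At G (A', B', T z) s l" if s: "s \<in> Xs" and l: "l \<in> Ls" for s l
    proof (rule eq_matI)
      fix r j assume "r < dim_row (At G (A', B', T z) s l)" "j < dim_col (At G (A', B', T z) s l)"
      then have rj: "r < rA G" "j < cA G" by simp_all
      have "polZA (T z) l r j = polZA z l r j + qA l r j"
        unfolding polZA_def T_sel by (rule polZ_shift[OF l rj qA(1) dA_def])
      then show "At G (A, B, z) s l $$ (r, j) = At G (A', B', T z) s l $$ (r, j)"
        unfolding At_index[OF z l rj] At_index[OF Tz l rj] sA_def[symmetric]
        by (simp add: qA(2)[OF s])
    qed simp_all
    moreover have "Bt G (A, B, z) s l = Bt G (A', B', T z) s l" if s: "s \<in> Xs" and l: "l \<in> Ls" for s l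
    proof (rule eq_matI)
      fix r j assume "r < dim_row (Bt G (A', B', T z) s l)" "j < dim_col (Bt G (A', B', T z) s l)"
      then have rj: "r < cA G" "j < cB G" by simp_all
      have "polZB (T z) l r j = polZB z l r j + qB l r j"
        unfolding polZB_def T_sel by (rule polZ_shift[OF l rj qB(1) dB_def])
      then show "Bt G (A, B, z) s l $$ (r, j) = Bt G (A', B', T z) s l $$ (r, j)"
        unfolding Bt_index[OF z l rj] Bt_index[OF Tz l rj] sB_def[symmetric]
        by (simp add: qB(2)[OF s])
    qed simp_all
    moreover have "Mset G (A, B, z) Xs = Mset G (A', B', T z) Xs"
      by (rule Mset_cong) simp_all
    ultimately show "((\<lambda>s\<in>Xs. shareA G (A, B, z) s), (\<lambda>s\<in>Xs. shareB G (A, B, z) s), Mset G (A, B, z) Xs) =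
        ((\<lambda>s\<in>Xs. shareA G (A', B', T z) s), (\<lambda>s\<in>Xs. shareB G (A', B', T z) s), Mset G (A', B', T z) Xs)"
      unfolding shareA_def shareB_def by (intro arg_cong2[where f = Pair] restrict_ext) auto
  qed
qed

subsection \<open>Independence and costs\<close>

lemma joint_eq: "joint G pA pB =
    map_pmf (\<lambda>(x, z). (fst x, snd x, z)) (pair_pmf (pair_pmf pA pB) (pmf_of_set (NoiseSpace G)))"
  by (simp add: joint_def pair_pmf_def map_bind_pmf bind_assoc_pmf bind_return_pmf)

lemma finite_joint:
  assumes "set_pmf pA \<subseteq> Aspace G" "set_pmf pB \<subseteq> Bspace G"
  shows "finite (set_pmf (joint G pA pB))"
proof -
  have "finite (Aspace G)" "finite (Bspace G)"
    unfolding Aspace_def Bspace_def by (intro finite_PiE finite_carrier_mat; simp)+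
  then have "finite (set_pmf pA)" "finite (set_pmf pB)" using assms finite_subset by blast+
  then show ?thesis
    by (simp add: joint_eq finite_NoiseSpace NoiseSpace_nonempty)
qed

text \<open>Noise is drawn independently of the inputs, so the conditional law of an observation is
  its law under the noise with the inputs held fixed.\<close>

lemma joint_kernel:
  "map_pmf (\<lambda>w. ((oA w, oB w), V w)) (joint G pA pB) =
    bind_pmf (pair_pmf pA pB) (\<lambda>x. map_pmf (Pair x) (map_pmf (\<lambda>z. V (fst x, snd x, z)) (pmf_of_set (NoiseSpace G))))"
  unfolding joint_eq pair_pmf_def[of "pair_pmf pA pB"]
  by (simp add: map_pmf_comp map_bind_pmf oA_def oB_def map_pmf_def[symmetric])

lemma joint_pair: "joint G pA pB = map_pmf (\<lambda>(ab, u, v). (fst ab, snd ab, noise_of (u, v)))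
    (pair_pmf (pair_pmf pA pB) (pair_pmf (pmf_of_set source_noise) (pmf_of_set server_noise)))"
  unfolding joint_eq pmf_of_NoiseSpace pair_map_pmf2
  by (simp add: map_pmf_comp apsnd_def map_prod_def split_def)

lemma X_security:
  assumes pAB: "set_pmf pA \<subseteq> Aspace G" "set_pmf pB \<subseteq> Bspace G"
    and Xs: "Xs \<subseteq> {1..gS G}" "card Xs \<le> gX G"
  shows "MI (joint G pA pB) (\<lambda>w. (oA w, oB w))
    (\<lambda>w. ((\<lambda>s\<in>Xs. shareA G w s), (\<lambda>s\<in>Xs. shareB G w s), Mset G w Xs)) = 0"
proof (rule MI_eq_0_pair_pmf[OF finite_joint[OF pAB]])
  let ?V = "\<lambda>w. ((\<lambda>s\<in>Xs. shareA G w s), (\<lambda>s\<in>Xs. shareB G w s), Mset G w Xs)"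
  \<comment> \<open>\<open>undefined\<close> is a legitimate reference input, because
    \<open>view_distribution\<close> compares arbitrary inputs.\<close>
  let ?r = "map_pmf (\<lambda>z. ?V (undefined, undefined, z)) (pmf_of_set (NoiseSpace G))"
  have "map_pmf (\<lambda>z. ?V (fst x, snd x, z)) (pmf_of_set (NoiseSpace G)) = ?r" for x
    by (rule view_distribution[OF Xs])
  then show "map_pmf (\<lambda>w. ((oA w, oB w), ?V w)) (joint G pA pB) = pair_pmf (pair_pmf pA pB) ?r"
    unfolding joint_kernel by (simp add: pair_pmf_def[of "pair_pmf pA pB"] map_pmf_def[symmetric])
qed

text \<open>Inputs and shares are functions of the inputs and the source noise, messages of the
  server noise alone, so the two sides are independent. The facts \<open>X\<close> and
  \<open>Y\<close> justify \<open>undefined\<close> in the unread components.\<close>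

lemma strong_security:
  assumes pAB: "set_pmf pA \<subseteq> Aspace G" "set_pmf pB \<subseteq> Bspace G"
  shows "MI (joint G pA pB)
    (\<lambda>w. (oA w, oB w, (\<lambda>s\<in>{1..gS G}. shareA G w s), (\<lambda>s\<in>{1..gS G}. shareB G w s)))
    (\<lambda>w. Mset G w {1..gS G}) = 0"
proof -
  let ?X = "\<lambda>w. (oA w, oB w, (\<lambda>s\<in>{1..gS G}. shareA G w s), (\<lambda>s\<in>{1..gS G}. shareB G w s))"
  let ?Y = "\<lambda>w. Mset G w {1..gS G}"
  let ?f = "\<lambda>(ab, u). ?X (fst ab, snd ab, noise_of (u, undefined))"
  let ?g = "\<lambda>v. ?Y (undefined, undefined, noise_of (undefined, v))"
  let ?U = "pmf_of_set source_noise" and ?W = "pmf_of_set server_noise"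
  have X: "?X (a, b, noise_of (u, v)) = ?X (a, b, noise_of (u, v'))" for a b u v v'
    unfolding shareA_def shareB_def At_def Bt_def PP_def QQ_def noise_of_def oA_def oB_def oN_def by simp
  have Y: "?Y (a, b, noise_of (u, v)) = ?Y (a', b', noise_of (u', v))" for a b u v a' b' u'
    by (rule Mset_cong) (simp_all add: noise_of_def)
  have "map_pmf (\<lambda>w. (?X w, ?Y w)) (joint G pA pB) =
      map_pmf (\<lambda>(ab, u, v). (?f (ab, u), ?g v)) (pair_pmf (pair_pmf pA pB) (pair_pmf ?U ?W))"
    unfolding joint_pair map_pmf_comp
    by (rule map_pmf_cong[OF refl], clarify, intro conjI, rule X, rule Y)
  also have "\<dots> = map_pmf (\<lambda>(abu, v). (?f abu, ?g v)) (pair_pmf (pair_pmf (pair_pmf pA pB) ?U) ?W)"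
    unfolding pair_pair_pmf[of "pair_pmf pA pB"] map_pmf_comp by (simp add: split_def)
  also have "\<dots> = pair_pmf (map_pmf ?f (pair_pmf (pair_pmf pA pB) ?U)) (map_pmf ?g ?W)"
    by (rule map_pair)
  finally show ?thesis by (rule MI_eq_0_pair_pmf[OF finite_joint[OF pAB]])
qed

lemma privacy:
  assumes pAB: "set_pmf pA \<subseteq> Aspace G" "set_pmf pB \<subseteq> Bspace G"
  shows "CMI (joint G pA pB) (\<lambda>w. (oA w, oB w)) (\<lambda>w. (\<lambda>s\<in>{1..gS G}. Yans G w s))
    (\<lambda>w. (\<lambda>l\<in>{1..gL G}. oA w l * oB w l)) = 0"
proof -
  define f where "f x = (\<lambda>l\<in>{1..gL G}. fst x l * snd x l)" for x :: "(nat \<Rightarrow> 'a mat) \<times> (nat \<Rightarrow> 'a mat)"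
  define D where "D x = map_pmf (\<lambda>z. \<lambda>s\<in>{1..gS G}. Yans G (fst x, snd x, z) s) (pmf_of_set (NoiseSpace G))" for x
  \<comment> \<open>The kernel must depend on the products only, so it uses a representative input
    with these products. The representative is taken from the support, hence lies in the spaces
    required by \<open>answers_distribution\<close>.\<close>
  define K where "K y = D (SOME x. x \<in> set_pmf (pair_pmf pA pB) \<and> f x = y)" for y
  have "D x = K (f x)" if x: "x \<in> set_pmf (pair_pmf pA pB)" for x
  proof -
    define x' where "x' = (SOME x'. x' \<in> set_pmf (pair_pmf pA pB) \<and> f x' = f x)"
    have x': "x' \<in> set_pmf (pair_pmf pA pB) \<and> f x' = f x"
      unfolding x'_def by (rule someI[of _ x]) (use x in simp)
    have "fst x \<in> Aspace G" "snd x \<in> Bspace G" "fst x' \<in> Aspace G" "snd x' \<in> Bspace G"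
      using x x' pAB by (auto simp: mem_Times_iff)
    then have "D x = D x'"
      unfolding D_def by (rule answers_distribution) (use x' in \<open>simp add: f_def\<close>)
    then show ?thesis by (simp add: K_def x'_def)
  qed
  then have "map_pmf (\<lambda>w. ((oA w, oB w), \<lambda>s\<in>{1..gS G}. Yans G w s)) (joint G pA pB) =
      bind_pmf (pair_pmf pA pB) (\<lambda>x. map_pmf (Pair x) (K (f x)))"
    unfolding joint_kernel by (intro bind_pmf_cong refl) (simp only: D_def)
  from CMI_eq_0_kernel[where K = K and f = f, OF finite_joint[OF pAB] this] show ?thesis
    by (simp only: f_def fst_conv snd_conv)
qed

lemma costs:
  assumes SR: "gS G \<ge> gR G"
  shows "UA G w = real (gS G) / real (gKc G * gp G * gm G)"
    and "UB G w = real (gS G) / real (gKc G * gp G * gn G)"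
    and "CC G w = (real (gS G) - 1) / real (gell G * gKc G * gm G * gn G)"
    and "DD G w = real (gR G) / real (gell G * gKc G * gm G * gn G)"
proof -
  show "UA G w = real (gS G) / real (gKc G * gp G * gm G)"
    using pos dims_pos by (simp add: UA_def msize_def gL_def dims)
  show "UB G w = real (gS G) / real (gKc G * gp G * gn G)"
    using pos dims_pos by (simp add: UB_def msize_def gL_def dims)
  \<comment> \<open>Each server other than the first receives a single block, from server 1; server
    1 receives none.\<close>
  have recv: "(\<Sum>s'\<in>{1..gS G} - {s}. case msg G w (s', s) of None \<Rightarrow> 0 | Some M \<Rightarrow> msize M)
      = (if s \<in> {2..gS G} then rA G * cB G else 0)" if s: "s \<in> {1..gS G}" for s
  proof -
    have "(\<Sum>s'\<in>{1..gS G} - {s}. case msg G w (s', s) of None \<Rightarrow> 0 | Some M \<Rightarrow> msize M)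
      = (\<Sum>s'\<in>{1..gS G} - {s}. if s' = 1 then if s \<in> {2..gS G} then rA G * cB G else 0 else 0)"
      by (intro sum.cong refl) (simp add: msg_def msize_def)
    also have "\<dots> = (if s \<in> {2..gS G} then rA G * cB G else 0)"
    proof (cases "s \<in> {2..gS G}")
      case True
      then have "1 \<in> {1..gS G} - {s}" using pos(1) by simp
      then show ?thesis using True by (simp add: sum.delta)
    next
      case False
      then show ?thesis by (simp only: if_False if_cancel sum.neutral_const)
    qed
    finally show ?thesis .
  qed
  have "(\<Sum>s\<in>{1..gS G}. \<Sum>s'\<in>{1..gS G} - {s}. case msg G w (s', s) of None \<Rightarrow> 0 | Some M \<Rightarrow> msize M)
      = (\<Sum>s\<in>{1..gS G}. if s \<in> {2..gS G} then rA G * cB G else 0)"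
    by (rule sum.cong[OF refl recv])
  also have "\<dots> = (\<Sum>s\<in>{2..gS G}. rA G * cB G)"
    by (rule sum.mono_neutral_cong_right) auto
  finally have total: "(\<Sum>s\<in>{1..gS G}. \<Sum>s'\<in>{1..gS G} - {s}. case msg G w (s', s) of None \<Rightarrow> 0 | Some M \<Rightarrow> msize M)
      = (gS G - 1) * (rA G * cB G)" by simp
  have size: "real (gL G * glam G * gmu G) = real (gell G * gKc G * gm G * gn G) * real (rA G * cB G)"
    by (simp add: gL_def dims mult_ac)
  have block: "real (rA G * cB G) \<noteq> 0" using dims_pos by simp
  have "real (gS G - 1) = real (gS G) - 1" using pos(1) by simp
  then show "CC G w = (real (gS G) - 1) / real (gell G * gKc G * gm G * gn G)"
    unfolding CC_def total size of_nat_mult[of "gS G - 1"] nonzero_mult_divide_mult_cancel_right[OF block] by (rule arg_cong)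
  \<comment> \<open>All answers have the same size, so the maximum runs over a single value;
    \<open>SR\<close> guarantees that a set of \<open>gR G\<close> servers exists.\<close>
  have download: "{\<Sum>s\<in>Rs. msize (Yans G w s) | Rs. Rs \<subseteq> {1..gS G} \<and> card Rs = gR G} = {gR G * (rA G * cB G)}"
  proof -
    have "gR G \<le> card {1..gS G}" using SR by simp
    then obtain Rs where Rs: "Rs \<subseteq> {1..gS G}" "card Rs = gR G" by (rule obtain_subset_with_card_n)
    have sz: "(\<Sum>s\<in>Rs'. msize (Yans G w s)) = card Rs' * (rA G * cB G)" for Rs'
      by (simp add: msize_def)
    show ?thesis
    proof (intro equalityI subsetI)
      fix x assume "x \<in> {\<Sum>s\<in>Rs. msize (Yans G w s) | Rs. Rs \<subseteq> {1..gS G} \<and> card Rs = gR G}"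
      then obtain Rs' where "x = (\<Sum>s\<in>Rs'. msize (Yans G w s))" "card Rs' = gR G" by blast
      then show "x \<in> {gR G * (rA G * cB G)}" by (simp only: sz singleton_iff)
    next
      fix x assume "x \<in> {gR G * (rA G * cB G)}"
      then have "x = (\<Sum>s\<in>Rs. msize (Yans G w s))" by (simp only: sz Rs singleton_iff)
      then show "x \<in> {\<Sum>s\<in>Rs. msize (Yans G w s) | Rs. Rs \<subseteq> {1..gS G} \<and> card Rs = gR G}"
        using Rs by blast
    qed
  qed
  show "DD G w = real (gR G) / real (gell G * gKc G * gm G * gn G)"
    unfolding DD_def download size Max_singleton of_nat_mult[of "gR G"] nonzero_mult_divide_mult_cancel_right[OF block] ..
qed

lemma recoverability:
  assumes "Rs \<subseteq> {1..gS G}" "card Rs = gR G"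
  shows "\<exists>dec. \<forall>w\<in>Omega G. dec (\<lambda>s\<in>Rs. Yans G w s) = (\<lambda>l\<in>{1..gL G}. oA w l * oB w l)"
proof (rule decoder_exists)
  fix w w' assume w: "w \<in> Omega G" "w' \<in> Omega G" and Y: "(\<lambda>s\<in>Rs. Yans G w s) = (\<lambda>s\<in>Rs. Yans G w' s)"
  obtain A B z A' B' z' where ww: "w = (A, B, z)" "w' = (A', B', z')" by (metis surj_pair)
  have "Yans G (A, B, z) s = Yans G (A', B', z') s" if "s \<in> Rs" for s
    using fun_cong[OF Y, of s] that ww by simp
  then have "(\<lambda>l\<in>{1..gL G}. A l * B l) = (\<lambda>l\<in>{1..gL G}. A' l * B' l)"
    using w assms unfolding ww Omega_def mem_Sigma_iff
    by (intro products_determined[where z = z and z' = z' and Rs = Rs]) simp_all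
  then show "(\<lambda>l\<in>{1..gL G}. oA w l * oB w l) = (\<lambda>l\<in>{1..gL G}. oA w' l * oB w' l)"
    by (simp only: ww oA_def oB_def fst_conv snd_conv)
qed

end

theorem theorem1:
  fixes G :: "'a::{field,finite} gparams"
    and pA pB :: "(nat \<Rightarrow> 'a mat) pmf"
  assumes pos: "gS G > 0" "gX G > 0" "gell G > 0" "gKc G > 0" "gp G > 0" "gm G > 0" "gn G > 0"
      "glam G > 0" "gkap G > 0" "gmu G > 0"
    and dvd: "gm G dvd glam G" "gp G dvd gkap G" "gn G dvd gmu G"
    and L_le: "gL G \<le> CARD('a) - gS G"
    and dist_alpha: "inj_on (galpha G) {1..gS G}"
    and dist_f: "inj_on (\<lambda>(l, k). gf G l k) ({1..gell G} \<times> {1..gKc G})"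
    and dist_af: "\<forall>s\<in>{1..gS G}. \<forall>l\<in>{1..gell G}. \<forall>k\<in>{1..gKc G}. galpha G s \<noteq> gf G l k"
    and SR: "gS G \<ge> gR G"
    and pA: "set_pmf pA \<subseteq> Aspace G"
    and pB: "set_pmf pB \<subseteq> Bspace G"
  shows
    \<comment> \<open>(i) correctness / R-recoverability\<close>
    "(\<forall>Rs. Rs \<subseteq> {1..gS G} \<and> card Rs = gR G \<longrightarrow>
        (\<exists>dec. \<forall>w\<in>Omega G.
            dec (\<lambda>s\<in>Rs. Yans G w s) = (\<lambda>l\<in>{1..gL G}. oA w l * oB w l)))
     \<and> \<comment> \<open>(ii) X-security\<close>
     (\<forall>Xs. Xs \<subseteq> {1..gS G} \<and> card Xs \<le> gX G \<longrightarrow>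
        MI (joint G pA pB) (\<lambda>w. (oA w, oB w))
           (\<lambda>w. ((\<lambda>s\<in>Xs. shareA G w s), (\<lambda>s\<in>Xs. shareB G w s), Mset G w Xs)) = 0)
     \<and> \<comment> \<open>(iii) strong security\<close>
     MI (joint G pA pB)
        (\<lambda>w. (oA w, oB w, (\<lambda>s\<in>{1..gS G}. shareA G w s), (\<lambda>s\<in>{1..gS G}. shareB G w s)))
        (\<lambda>w. Mset G w {1..gS G}) = 0
     \<and> \<comment> \<open>(iv) privacy\<close>
     CMI (joint G pA pB) (\<lambda>w. (oA w, oB w)) (\<lambda>w. (\<lambda>s\<in>{1..gS G}. Yans G w s))
        (\<lambda>w. (\<lambda>l\<in>{1..gL G}. oA w l * oB w l)) = 0
     \<and> \<comment> \<open>(v) costs\<close>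
     (\<forall>w\<in>Omega G.
        UA G w = real (gS G) / real (gKc G * gp G * gm G)
      \<and> UB G w = real (gS G) / real (gKc G * gp G * gn G)
      \<and> CC G w = (real (gS G) - 1) / real (gell G * gKc G * gm G * gn G)
      \<and> DD G w = real (gR G) / real (gell G * gKc G * gm G * gn G))"
proof -
  interpret gcsa G
    by unfold_locales (fact pos dvd dist_alpha dist_f dist_af)+
  show ?thesis
    by (intro conjI allI impI ballI recoverability X_security[OF pA pB] strong_security[OF pA pB]
        privacy[OF pA pB] costs[OF SR]) simp_all
qed

end
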